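(* Assume (A) and $\mathbf p=\mathbf u$. Then $$n\begin{pmatrix}H(\hat{\mathbf p})/\log m!-1\\ C(\hat{\mathbf p})\end{pmatrix}\xrightarrow{d}\begin{pmatrix}-\frac{m!}{2\log m!}\\[2pt] \frac{m!}{8}D_0\end{pmatrix}Q_m.$$
   Context: Setting: $m\ge2$; $(\Pi_t)$ is the stationary series of ordinal patterns of length $m$ of an underlying process, with values in the $m!$ OPs $\pi_1,\dots,\pi_{m!}$; $\mathbf p=(p_1,\dots,p_{m!})$, $p_i=\mathbb P(\Pi_0=\pi_i)$; $\hat{\mathbf p}$ is the vector of relative frequencies $\hat p_i=\frac1n\sum_{t=1}^n\mathbb 1\{\Pi_t=\pi_i\}$; $p_{ij}(k)=\mathbb P(\Pi_0=\pi_i,\Pi_k=\pi_j)$; $\Sigma=(\sigma_{ij})$ with $\sigma_{ij}=p_i(\delta_{ij}-p_j)+\sum_{k=1}^\infty(p_{ij}(k)+p_{ji}(k)-2p_ip_j)$ (absolutely convergent). Standing assumption (A): $\sqrt n(\hat{\mathbf p}-\mathbf p)\xrightarrow{d}N(\mathbf 0,\Sigma)$. $\mathbf u=(1/m!,\dots,1/m!)$. Shannon entropy $H(\mathbf p)=-\sum_k p_k\log p_k$ with $0\log0:=0$; $H_0=1/\log m!$. Disequilibrium $D(\mathbf p)=H((\mathbf p+\mathbf u)/2)-\frac12H(\mathbf p)-\frac12\log m!$; $D_0^{-1}=-\frac{m!+1}{2m!}\log(m!+1)+\log(2m!)-\frac12\log m!$. Complexity $C(\mathbf p)=D_0D(\mathbf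 p)\cdot H_0H(\mathbf p)$. $Q_m=\sum_{i=1}^l\lambda_i\chi^2_{r_i}$, where $\lambda_1,\dots,\lambda_l$ are the distinct nonzero eigenvalues of $\Sigma$ with algebraic multiplicities $r_1,\dots,r_l$ and $\chi^2_{r_i}$ are independent chi-square random variables with $r_i$ degrees of freedom. *)

theory Defs
  imports "HOL-Probability.Probability" "HOL-Computational_Algebra.Polynomial"
    "HOL-Combinatorics.Permutations"
begin

text \<open>Ordinal pattern (rank vector) of the window x 0, ..., x (m-1); ties broken by time index.
  The result permutes {..<m}.\<close>
definition ordpat :: "nat \<Rightarrow> (nat \<Rightarrow> real) \<Rightarrow> (nat \<Rightarrow> nat)" where
  "ordpat m x = (\<lambda>i. if i < m then card {j. j < m \<and> (x j < x i \<or> (x j = x i \<and> j < i))} else i)"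

definition shannon :: "real^'k \<Rightarrow> real" where
  "shannon q = - (\<Sum>k\<in>UNIV. (if q$k = 0 then 0 else q$k * ln (q$k)))"

definition unif :: "nat \<Rightarrow> real^'k" where
  "unif m = (\<chi> i. 1 / fact m)"

definition H0 :: "nat \<Rightarrow> real" where
  "H0 m = 1 / ln (fact m)"

definition disequilibrium :: "nat \<Rightarrow> real^'k \<Rightarrow> real" where
  "disequilibrium m q = shannon ((1/2) *\<^sub>R (q + unif m)) - shannon q / 2 - ln (fact m) / 2"

definition D0 :: "nat \<Rightarrow> real" where
  "D0 m = 1 / (- ((fact m + 1) / (2 * fact m)) * ln (fact m + 1) + ln (2 * fact m) - ln (fact m) / 2)"

definition complexity :: "nat \<Rightarrow> real^'k \<Rightarrow> real" where
  "complexity m q = D0 m * disequilibrium m q * (H0 m * shannon q)"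

definition charpoly :: "real^'k^'k \<Rightarrow> real poly" where
  "charpoly A = det (\<chi> i j. [: - (A$i$j), (if i = j then 1 else 0) :])"

definition nonzero_eigenvalues :: "real^'k^'k \<Rightarrow> real set" where
  "nonzero_eigenvalues A = {c. c \<noteq> 0 \<and> poly (charpoly A) c = 0}"

definition alg_mult :: "real^'k^'k \<Rightarrow> real \<Rightarrow> nat" where
  "alg_mult A c = order c (charpoly A)"

definition gaussian_measure :: "real^'k^'k \<Rightarrow> (real^'k) measure \<Rightarrow> bool" where
  "gaussian_measure S \<mu> \<longleftrightarrow> sets \<mu> = sets borel \<and> prob_space \<mu> \<and>
     (\<forall>t. (\<integral>x. cis (t \<bullet> x) \<partial>\<mu>) = complex_of_real (exp (- (t \<bullet> (S *v t)) / 2)))"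

definition chi_square_density :: "nat \<Rightarrow> real \<Rightarrow> real" where
  "chi_square_density r x = (if x > 0 then
     x powr (real r / 2 - 1) * exp (- x / 2) / (2 powr (real r / 2) * Gamma (real r / 2)) else 0)"

definition conv_distr ::
  "'a measure \<Rightarrow> (nat \<Rightarrow> 'a \<Rightarrow> 'b::topological_space) \<Rightarrow> 'b measure \<Rightarrow> bool" where
  "conv_distr M Z \<mu> \<longleftrightarrow>
     (\<forall>g :: 'b \<Rightarrow> real. continuous_on UNIV g \<longrightarrow> bounded (range g) \<longrightarrow>
        (\<lambda>n. \<integral>\<omega>. g (Z n \<omega>) \<partial>M) \<longlonglongrightarrow> (\<integral>x. g x \<partial>\<mu>))"

end

theory Submission
  imports Defs "HOL-Real_Asymp.Real_Asymp"
begin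

text \<open>
  With \<open>K = m!\<close> and \<open>h y = y ln y - y + 1\<close>, on the probability simplex
  \<open>H q = ln K - (1/K) \<Sum>k. h (K q\<^sub>k)\<close> and
  \<open>D q = (1/(2K)) \<Sum>k. h (K q\<^sub>k) - (1/K) \<Sum>k. h ((K q\<^sub>k + 1)/2)\<close>. As \<open>h (1 + x) = x\<^sup>2/2 + o(x\<^sup>2)\<close>,
  the statistic is a function of \<open>Z\<^sub>n = \<surd>n (p\<^sub>n - u)\<close>, with \<open>p\<^sub>n\<close> the empirical frequencies,
  converging uniformly on balls to a multiple of \<open>|z|\<^sup>2\<close>; an extended continuous mapping theorem
  gives the limit in terms of \<open>|Z|\<^sup>2\<close> with \<open>Z \<sim> N(0, \<Sigma>)\<close>.

  The law of \<open>|Z|\<^sup>2\<close> is identified by its Laplace transform. If \<open>b\<^sub>i\<close> is an orthonormal eigenbasis of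
  \<open>\<Sigma>\<close> with eigenvalues \<open>d\<^sub>i\<close>, and \<open>\<xi>\<^sub>i\<close> are independent standard normal variables, then
  \<open>exp (- s |x|\<^sup>2 / 2) = E cis (\<surd>s \<Sum>i. \<xi>\<^sub>i (b\<^sub>i \<bullet> x))\<close>. Integrating over \<open>x\<close> first, only the
  characteristic function of \<open>Z\<close> enters, and \<open>E exp (- s |Z|\<^sup>2 / 2) = \<Prod>i. (1 + s d\<^sub>i)\<^sup>-\<^sup>1\<^sup>/\<^sup>2\<close>, which is
  also the transform of the weighted chi-square sum.
\<close>

section \<open>Orthonormal eigenbases and the characteristic polynomial\<close>

text \<open>The Rayleigh quotient attains its maximum on the compact unit sphere of
  \<open>S\<close>. The first-order condition at a maximiser \<open>v\<close> makes the residual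
  \<open>c *\<^sub>R v - f v\<close> orthogonal to \<open>S\<close>, while invariance puts it into
  \<open>S\<close>.\<close>

lemma selfadjoint_subspace_eigenvector:
  fixes f :: "'a::euclidean_space \<Rightarrow> 'a"
  assumes f: "linear f" and sa: "\<And>x y. f x \<bullet> y = x \<bullet> f y"
    and S: "subspace S" "f ` S \<subseteq> S" "S \<noteq> {0}"
  obtains v c where "v \<in> S" "norm v = 1" "f v = c *\<^sub>R v"
proof -
  let ?K = "S \<inter> sphere 0 1"
  have "compact ?K"
    by (intro closed_Int_compact closed_subspace compact_sphere S(1))
  moreover have "?K \<noteq> {}"
  proof -
    obtain x where "x \<in> S" "x \<noteq> 0"
      using S(1,3) subspace_0 by blast
    then have "(1 / norm x) *\<^sub>R x \<in> ?K"
      using S(1) by (simp add: subspace_scale)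
    then show ?thesis by blast
  qed
  moreover have "continuous_on ?K (\<lambda>x. x \<bullet> f x)"
    using f by (intro continuous_intros linear_continuous_on) (simp add: linear_linear)
  ultimately obtain v where v: "v \<in> ?K" and max: "\<And>x. x \<in> ?K \<Longrightarrow> x \<bullet> f x \<le> v \<bullet> f v"
    using continuous_attains_sup by metis
  define c where "c = v \<bullet> f v"
  have vS: "v \<in> S" and nv: "norm v = 1" and vv: "v \<bullet> v = 1"
    using v by (auto simp: dot_square_norm)
  have nonneg: "0 \<le> c * (x \<bullet> x) - x \<bullet> f x" if "x \<in> S" for x
  proof (cases "x = 0")
    case True
    then show ?thesis by simp
  next
    case False
    have "(1 / norm x) *\<^sub>R x \<in> ?K"
      using S(1) that False by (simp add: subspace_scale)
    from max[OF this] have "(x \<bullet> f x) / (norm x)\<^sup>2 \<le> c"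
      using f by (simp add: linear_cmul c_def power2_eq_square)
    then show ?thesis
      using False by (simp add: field_simps power2_norm_eq_inner)
  qed
  \<comment> \<open>The positive semidefinite form \<open>c |x|\<^sup>2 - x \<bullet> f x\<close> vanishes at \<open>v\<close>, hence so does its gradient.\<close>
  have orth: "w \<bullet> (c *\<^sub>R v - f v) = 0" if w: "w \<in> S" for w
  proof -
    define a where "a = w \<bullet> (c *\<^sub>R v - f v)"
    define q where "q = c * (w \<bullet> w) - w \<bullet> f w"
    have ineq: "0 \<le> 2 * t * a + t\<^sup>2 * q" for t
    proof -
      have "v + t *\<^sub>R w \<in> S"
        using S(1) vS w by (simp add: subspace_add subspace_scale)
      from nonneg[OF this] show ?thesis
        using sa[of v w] vv f
        by (simp add: linear_add linear_cmul inner_add_left inner_add_right inner_diff_right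
            a_def q_def c_def[symmetric] power2_eq_square algebra_simps inner_commute)
    qed
    have "a = 0"
    proof (rule ccontr)
      assume "a \<noteq> 0"
      \<comment> \<open>Replacing \<open>q\<close> by the positive bound \<open>r\<close> covers
        either sign of \<open>q\<close>; the quadratic \<open>2 * t * a + t\<^sup>2 * r\<close> is
        minimised at \<open>- a / r\<close>.\<close>
      define r where "r = \<bar>q\<bar> + 1"
      have r: "r > 0" "q \<le> r" by (auto simp: r_def)
      define t where "t = - a / r"
      have "2 * t * a + t\<^sup>2 * q \<le> 2 * t * a + t\<^sup>2 * r"
        using r by (intro add_left_mono mult_left_mono) auto
      also have "\<dots> = - (a\<^sup>2 / r)"
        using r unfolding t_def by (simp add: field_simps power2_eq_square)
      also have "\<dots> < 0"
        using \<open>a \<noteq> 0\<close> r by simp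
      finally show False using ineq[of t] by simp
    qed
    then show ?thesis by (simp add: a_def)
  qed
  have "c *\<^sub>R v - f v \<in> S"
    using S vS by (intro subspace_diff subspace_scale) auto
  \<comment> \<open>Taking the residual itself for \<open>w\<close> shows that it is orthogonal to
    itself.\<close>
  from orth[OF this] have "f v = c *\<^sub>R v" by simp
  with vS nv that show thesis by blast
qed

text \<open>An orthonormal set of eigenvectors of maximal size spans: otherwise its orthogonal
  complement is nonzero and, by self-adjointness, invariant, so it contains a further unit
  eigenvector. Indexing the basis by \<open>'n\<close> lets it form the columns of a square
  matrix.\<close>

lemma symmetric_matrix_eigenbasis:
  fixes A :: "real^'n^'n"
  assumes sym: "transpose A = A"
  obtains b :: "'n \<Rightarrow> real^'n" and d :: "'n \<Rightarrow> real"
  where "\<And>i j. b i \<bullet> b j = (if i = j then 1 else 0)" "\<And>i. A *v b i = d i *\<^sub>R b i"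
proof -
  have sa: "(A *v x) \<bullet> y = x \<bullet> (A *v y)" for x y
    using dot_lmul_matrix[of x A y] sym by (metis transpose_matrix_vector)
  define good where "good B \<longleftrightarrow> pairwise orthogonal B \<and> (\<forall>v\<in>B. norm v = 1 \<and> (\<exists>c. A *v v = c *\<^sub>R v))"
    for B :: "(real^'n) set"
  have indep: "independent B" if "good B" for B
    using that by (intro pairwise_orthogonal_independent) (auto simp: good_def)
  have bound: "card B \<le> CARD('n)" "finite B" if "good B" for B
    using independent_bound[OF indep[OF that]] by auto
  have "good {}" by (simp add: good_def)
  then obtain B where B: "good B" and max: "\<And>C. good C \<Longrightarrow> card C \<le> card B"
    using ex_has_greatest_nat[of good "{}" card "Suc CARD('n)"] bound(1) by (auto simp: less_Suc_eq_le)
  have "span B = UNIV"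
  proof (rule ccontr)
    assume ne: "span B \<noteq> UNIV"
    define S where "S = {x. \<forall>v\<in>B. orthogonal v x}"
    have "subspace S"
      unfolding S_def by (rule subspace_orthogonal_to_vectors)
    moreover have "(*v) A ` S \<subseteq> S"
    proof clarify
      fix x assume x: "x \<in> S"
      show "A *v x \<in> S"
        unfolding S_def orthogonal_def
      proof clarify
        fix v assume "v \<in> B"
        then obtain c where "A *v v = c *\<^sub>R v" "v \<bullet> x = 0"
          using B x by (auto simp: good_def S_def orthogonal_def)
        then show "v \<bullet> (A *v x) = 0"
          using sa[of v x] by simp
      qed
    qed
    moreover have "S \<noteq> {0}"
    proof -
      have "dim B < DIM(real^'n)"
        using ne by (metis dim_eq_full dim_subset_UNIV le_neq_implies_less)
      then obtain x where "x \<noteq> 0" "\<And>y. y \<in> span B \<Longrightarrow> orthogonal x y"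
        using orthogonal_to_subspace_exists by blast
      then show ?thesis
        by (auto simp: S_def orthogonal_commute span_base)
    qed
    ultimately obtain v c where v: "v \<in> S" "norm v = 1" "A *v v = c *\<^sub>R v"
      using selfadjoint_subspace_eigenvector[of "(*v) A" S] sa by (metis matrix_vector_mul_linear)
    have "v \<notin> B"
      using v(1,2) by (auto simp: S_def orthogonal_def)
    moreover have "good (insert v B)"
      using B v by (auto simp: good_def pairwise_insert S_def orthogonal_commute)
    ultimately show False
      using max[of "insert v B"] bound(2)[OF B] by simp
  qed
  then have "card B = CARD('n)"
    using indep[OF B] by (metis dim_UNIV dim_eq_card_independent dim_span DIM_cart DIM_real mult.right_neutral)
  then obtain b where b: "bij_betw b (UNIV :: 'n set) B"
    using bound(2)[OF B] finite_same_card_bij[of "UNIV :: 'n set" B] by auto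
  have bB: "b i \<in> B" for i
    using b by (auto simp: bij_betw_def)
  have "b i \<bullet> b j = (if i = j then 1 else 0)" for i j
  proof (cases "i = j")
    case True
    then show ?thesis
      using B bB[of j] by (simp add: good_def dot_square_norm)
  next
    case False
    then have "b i \<noteq> b j"
      using b by (metis UNIV_I bij_betw_inv_into_left)
    then show ?thesis
      using B bB[of i] bB[of j] False by (auto simp: good_def pairwise_def orthogonal_def)
  qed
  moreover have "\<forall>i. \<exists>c. A *v b i = c *\<^sub>R b i"
    using B bB by (auto simp: good_def)
  ultimately show thesis
    using that by metis
qed

text \<open>With the \<open>b i\<close> as columns of \<open>P\<close>, the characteristic matrix
  satisfies \<open>C ** P = P ** D\<close> with \<open>D\<close> diagonal. All entries are
  polynomials, so the determinants lie in an integral domain and the nonzero factor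
  \<open>det P\<close> cancels.\<close>

lemma charpoly_orthonormal_eigenbasis:
  fixes A :: "real^'n^'n" and b :: "'n \<Rightarrow> real^'n"
  assumes b: "\<And>i j. b i \<bullet> b j = (if i = j then 1 else 0)"
    and d: "\<And>i. A *v b i = d i *\<^sub>R b i"
  shows "charpoly A = (\<Prod>i\<in>UNIV. [:- d i, 1:])"
proof -
  define P :: "real poly^'n^'n" where "P = (\<chi> i j. [:b j $ i:])"
  define D :: "real poly^'n^'n" where "D = (\<chi> i j. if i = j then [:- d i, 1:] else 0)"
  define C :: "real poly^'n^'n" where "C = (\<chi> i j. [: - (A$i$j), (if i = j then 1 else 0) :])"
  have "transpose P ** P = mat 1"
  proof -
    have "(\<Sum>k\<in>UNIV. [:b i $ k:] * [:b j $ k:]) = (if i = j then 1 else 0)" for i j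
    proof -
      have "poly (\<Sum>k\<in>UNIV. [:b i $ k:] * [:b j $ k:]) = poly (if i = j then 1 else 0)"
        using b[of i j] by (auto simp: poly_sum inner_vec_def fun_eq_iff mult.commute)
      then show ?thesis by (simp only: poly_eq_poly_eq_iff)
    qed
    then show ?thesis
      by (simp add: P_def transpose_def matrix_matrix_mult_def mat_def vec_eq_iff)
  qed
  then have "det (transpose P ** P) = 1"
    by (simp add: det_I)
  then have detP: "det P \<noteq> 0"
    by (auto simp: det_mul)
  have "C ** P = P ** D"
  proof -
    have "(\<Sum>k\<in>UNIV. [: - (A$i$k), (if i = k then 1 else 0) :] * [:b j $ k:]) = [:b j $ i:] * [:- d j, 1:]"
      for i j
    proof -
      have "(A *v b j) $ i = d j * b j $ i" using d[of j] by simp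
      then have "(\<Sum>k\<in>UNIV. A $ i $ k * b j $ k) = d j * b j $ i"
        by (simp add: matrix_vector_mult_def)
      then have "poly (\<Sum>k\<in>UNIV. [: - (A$i$k), (if i = k then 1 else 0) :] * [:b j $ k:]) x
          = poly ([:b j $ i:] * [:- d j, 1:]) x" for x
        by (simp add: poly_sum algebra_simps sum.distrib sum_subtractf sum_negf sum_distrib_left[symmetric]
            if_distrib[of "\<lambda>p. poly p x"] if_distrib[of "(*) y" for y] cong: if_cong)
      then show ?thesis by (simp only: poly_eq_poly_eq_iff[symmetric] fun_eq_iff) blast
    qed
    then show ?thesis
      by (simp add: C_def P_def D_def matrix_matrix_mult_def vec_eq_iff
          if_distrib[of "(*) y" for y] cong: if_cong)
  qed
  then have "det C * det P = det P * det D"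
    by (metis det_mul)
  then have "det C = det D"
    using detP by simp
  also have "det D = (\<Prod>i\<in>UNIV. [:- d i, 1:])"
    by (subst det_diagonal) (auto simp: D_def)
  finally show ?thesis
    by (simp add: charpoly_def C_def)
qed

text \<open>Orders add over nonzero products, and a monic linear factor has order one at its root
  and zero elsewhere.\<close>

lemma order_prod_linear_factors:
  fixes d :: "'i \<Rightarrow> 'a::idom"
  assumes "finite I"
  shows "order c (\<Prod>i\<in>I. [:- d i, 1:]) = card {i \<in> I. d i = c}"
  using assms
proof (induction I)
  case empty
  then show ?case by simp
next
  case (insert i I)
  have "order c [:- d i, 1:] = (if d i = c then 1 else 0)"
    using order_power_n_n[of c 1] by (auto simp: order_root intro!: order_0I)
  moreover have "{j \<in> insert i I. d j = c} = (if d i = c then insert i {j \<in> I. d j = c} else {j \<in> I. d j = c})"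
    by auto
  moreover have "[:- d i, 1:] * (\<Prod>i\<in>I. [:- d i, 1:]) \<noteq> 0"
    using insert.hyps(1) by (simp add: prod_zero_iff del: mult_pCons_left)
  ultimately show ?case
    using insert by (simp add: order_mult del: mult_pCons_left)
qed

text \<open>Turns roots and their orders into counts over the index type, so that a product over
  eigenvalues with multiplicities can be compared with a product over \<open>i\<close>.\<close>

lemma eigenvalues_orthonormal_eigenbasis:
  fixes A :: "real^'n^'n" and b :: "'n \<Rightarrow> real^'n"
  assumes "\<And>i j. b i \<bullet> b j = (if i = j then 1 else 0)" "\<And>i. A *v b i = d i *\<^sub>R b i"
  shows "nonzero_eigenvalues A = range d - {0}" "alg_mult A c = card {i. d i = c}"
  using order_prod_linear_factors[of UNIV c d]
  by (auto simp: nonzero_eigenvalues_def alg_mult_def charpoly_orthonormal_eigenbasis[OF assms] poly_prod)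

section \<open>Laplace transforms of Gaussian and chi-square laws\<close>

lemma integrable_bounded_measurable:
  fixes f :: "'a \<Rightarrow> 'b::{banach, second_countable_topology}"
  assumes "finite_measure M" "f \<in> borel_measurable M" "\<And>x. x \<in> space M \<Longrightarrow> norm (f x) \<le> B"
  shows "integrable M f"
  using assms by (intro finite_measure.integrable_const_bound[where B=B]) auto

text \<open>Tilting the standard normal density by the exponential gives \<open>\<sigma>\<close>
  times the centred normal density of variance \<open>1 / (1 + a)\<close>, whose integral is
  one.\<close>

lemma expectation_exp_neg_square_std_normal:
  assumes "0 \<le> a"
  shows "(\<integral>x. exp (- (a * x\<^sup>2) / 2) \<partial>std_normal_distribution) = 1 / sqrt (1 + a)"
proof -
  define \<sigma> where "\<sigma> = 1 / sqrt (1 + a)"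
  have \<sigma>: "\<sigma> > 0" "\<sigma>\<^sup>2 = 1 / (1 + a)"
    using assms by (auto simp: \<sigma>_def power_divide)
  have "std_normal_density x * exp (- (a * x\<^sup>2) / 2) = \<sigma> * normal_density 0 \<sigma> x" for x
  proof -
    have "exp (- x\<^sup>2 / 2) * exp (- (a * x\<^sup>2) / 2) = exp (- x\<^sup>2 / (2 * \<sigma>\<^sup>2))"
      using assms by (simp add: \<sigma> exp_add[symmetric] field_simps)
    moreover have "sqrt (2 * pi * \<sigma>\<^sup>2) = sqrt (2 * pi) * \<sigma>"
      using \<sigma>(1) by (simp add: real_sqrt_mult)
    ultimately show ?thesis
      using \<sigma>(1) by (simp add: normal_density_def)
  qed
  then have "(\<integral>x. exp (- (a * x\<^sup>2) / 2) \<partial>std_normal_distribution)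
      = (\<integral>x. \<sigma> * normal_density 0 \<sigma> x \<partial>lborel)"
    by (subst integral_density) auto
  also have "\<dots> = \<sigma>"
    using \<sigma>(1) by simp
  finally show ?thesis by (simp add: \<sigma>_def)
qed

text \<open>The law is given only by its characteristic function, and \<open>S\<close> may be
  singular, so there need not be a density to integrate against. Averaging over the Gaussian random
  frequency \<open>t \<xi>\<close> reduces the transform to values of that characteristic
  function.\<close>

lemma gaussian_measure_laplace_norm_square:
  fixes S :: "real^'n^'n" and b :: "'n \<Rightarrow> real^'n"
  assumes \<mu>: "gaussian_measure S \<mu>"
    and b: "\<And>i j. b i \<bullet> b j = (if i = j then 1 else 0)"
    and d: "\<And>i. S *v b i = d i *\<^sub>R b i"
    and d_nonneg: "\<And>i. 0 \<le> d i" and s: "0 \<le> s"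
  shows "(\<integral>x. exp (- (s * (norm x)\<^sup>2) / 2) \<partial>\<mu>) = (\<Prod>i\<in>UNIV. 1 / sqrt (1 + s * d i))"
proof -
  interpret \<mu>: prob_space \<mu> using \<mu> by (simp add: gaussian_measure_def)
  have sets_\<mu> [measurable_cong]: "sets \<mu> = sets borel" using \<mu> by (simp add: gaussian_measure_def)
  interpret N: prob_space std_normal_distribution
    by (rule prob_space_normal_density) simp
  interpret P: product_prob_space "\<lambda>_::'n. std_normal_distribution" UNIV ..
  let ?P = "Pi\<^sub>M (UNIV :: 'n set) (\<lambda>_. std_normal_distribution)"
  interpret pair_prob_space \<mu> ?P ..
  define t where "t \<xi> = sqrt s *\<^sub>R (\<Sum>i\<in>UNIV. \<xi> i *\<^sub>R b i)" for \<xi> :: "'n \<Rightarrow> real"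
  have [measurable]: "cis \<in> borel_measurable borel"
    by (intro borel_measurable_continuous_onI continuous_intros)
  have [measurable]: "t \<in> borel_measurable ?P"
    unfolding t_def by measurable
  have norm_sum: "(norm x)\<^sup>2 = (\<Sum>i\<in>UNIV. (b i \<bullet> x)\<^sup>2)" for x
  proof -
    \<comment> \<open>The rows of \<open>Q\<close> are the \<open>b i\<close>, so Parseval's
      identity is the orthogonality of \<open>Q\<close>.\<close>
    define Q where "Q = (\<chi> i j. b i $ j)"
    have "Q ** transpose Q = mat 1"
      using b by (simp add: Q_def transpose_def matrix_matrix_mult_def mat_def inner_vec_def vec_eq_iff)
    then have "orthogonal_matrix Q"
      by (metis orthogonal_matrix transpose_transpose orthogonal_matrix_transpose)
    then have "norm (Q *v x) = norm x"
      by (metis orthogonal_transformation_matrix matrix_of_matrix_vector_mul matrix_vector_mul_linear orthogonal_transformation)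
    moreover have "(Q *v x) $ i = b i \<bullet> x" for i
      by (simp add: Q_def matrix_vector_mult_def inner_vec_def)
    moreover have "(norm (Q *v x))\<^sup>2 = (\<Sum>i\<in>UNIV. ((Q *v x) $ i)\<^sup>2)"
      unfolding power2_norm_eq_inner by (simp add: inner_vec_def power2_eq_square)
    ultimately show ?thesis by simp
  qed
  have inner_t: "t \<xi> \<bullet> x = (\<Sum>i\<in>UNIV. \<xi> i * (sqrt s * (b i \<bullet> x)))" for \<xi> x
    by (simp add: t_def inner_sum_left sum_distrib_left algebra_simps)
  \<comment> \<open>The form is diagonal in the eigenbasis, so after the exchange of integrals the
    integrand in \<open>\<xi>\<close> is again a product over coordinates.\<close>
  have quad_t: "t \<xi> \<bullet> (S *v t \<xi>) = (\<Sum>i\<in>UNIV. s * d i * (\<xi> i)\<^sup>2)" for \<xi>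
  proof -
    have "S *v t \<xi> = sqrt s *\<^sub>R (\<Sum>i\<in>UNIV. (\<xi> i * d i) *\<^sub>R b i)"
      by (simp add: t_def matrix_vector_mult_scaleR linear_sum[OF matrix_vector_mul_linear] d)
    then have "t \<xi> \<bullet> (S *v t \<xi>)
        = (sqrt s * sqrt s) * ((\<Sum>i\<in>UNIV. \<xi> i *\<^sub>R b i) \<bullet> (\<Sum>i\<in>UNIV. (\<xi> i * d i) *\<^sub>R b i))"
      by (simp only: t_def inner_scaleR_left inner_scaleR_right mult.assoc)
    also have "\<dots> = s * (\<Sum>i\<in>UNIV. \<xi> i * (\<xi> i * d i))"
      using s by (simp add: inner_sum_left inner_sum_right b if_distrib[of "(*) y" for y] mult_ac cong: if_cong)
    finally show ?thesis
      by (simp add: sum_distrib_left power2_eq_square algebra_simps)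
  qed
  have "complex_of_real (\<integral>x. exp (- (s * (norm x)\<^sup>2) / 2) \<partial>\<mu>)
      = (\<integral>x. complex_of_real (exp (- (s * (norm x)\<^sup>2) / 2)) \<partial>\<mu>)"
    by simp
  also have "\<dots> = (\<integral>x. (\<integral>\<xi>. cis (t \<xi> \<bullet> x) \<partial>?P) \<partial>\<mu>)"
  proof (rule Bochner_Integration.integral_cong)
    fix x
    \<comment> \<open>For fixed \<open>x\<close> the product measure splits the mean into standard
      normal characteristic functions, one for each coordinate of \<open>x\<close> in the
      basis.\<close>
    have "(\<integral>\<xi>. cis (t \<xi> \<bullet> x) \<partial>?P) = (\<integral>\<xi>. (\<Prod>i\<in>UNIV. cis (\<xi> i * (sqrt s * (b i \<bullet> x)))) \<partial>?P)"
      by (simp add: inner_t cis_conv_exp exp_sum[symmetric] sum_distrib_left)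
    also have "\<dots> = (\<Prod>i\<in>UNIV. \<integral>y. cis (y * (sqrt s * (b i \<bullet> x))) \<partial>std_normal_distribution)"
      by (rule P.product_integral_prod)
        (auto intro!: integrable_bounded_measurable[where B=1] N.finite_measure_axioms)
    also have "\<dots> = (\<Prod>i\<in>UNIV. char std_normal_distribution (sqrt s * (b i \<bullet> x)))"
      by (simp add: char_def cis_conv_exp mult.commute)
    also have "\<dots> = (\<Prod>i\<in>UNIV. complex_of_real (exp (- (s * (b i \<bullet> x)\<^sup>2) / 2)))"
      using s by (simp add: char_std_normal_distribution power_mult_distrib)
    also have "\<dots> = complex_of_real (exp (- (s * (norm x)\<^sup>2) / 2))"
      by (simp add: norm_sum exp_sum[symmetric] sum_distrib_left sum_divide_distrib sum_negf flip: of_real_prod)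
    finally show "complex_of_real (exp (- (s * (norm x)\<^sup>2) / 2)) = (\<integral>\<xi>. cis (t \<xi> \<bullet> x) \<partial>?P)" ..
  qed simp
  also have "\<dots> = (\<integral>\<xi>. (\<integral>x. cis (t \<xi> \<bullet> x) \<partial>\<mu>) \<partial>?P)"
    by (rule Fubini_integral[symmetric])
      (auto intro!: integrable_bounded_measurable[where B=1] finite_measure_axioms simp: split_beta)
  also have "\<dots> = (\<integral>\<xi>. complex_of_real (\<Prod>i\<in>UNIV. exp (- (s * d i * (\<xi> i)\<^sup>2) / 2)) \<partial>?P)"
    using \<mu> by (simp add: gaussian_measure_def quad_t exp_sum[symmetric] sum_divide_distrib sum_negf)
  also have "\<dots> = complex_of_real (\<integral>\<xi>. (\<Prod>i\<in>UNIV. exp (- (s * d i * (\<xi> i)\<^sup>2) / 2)) \<partial>?P)"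
    by (rule integral_complex_of_real)
  also have "(\<integral>\<xi>. (\<Prod>i\<in>UNIV. exp (- (s * d i * (\<xi> i)\<^sup>2) / 2)) \<partial>?P)
      = (\<Prod>i\<in>UNIV. \<integral>y. exp (- (s * d i * y\<^sup>2) / 2) \<partial>std_normal_distribution)"
    using s d_nonneg by (intro P.product_integral_prod)
        (auto intro!: integrable_bounded_measurable[where B=1] N.finite_measure_axioms)
  also have "\<dots> = (\<Prod>i\<in>UNIV. 1 / sqrt (1 + s * d i))"
    using s d_nonneg by (intro prod.cong refl expectation_exp_neg_square_std_normal) auto
  finally show ?thesis
    by (simp only: of_real_eq_iff)
qed

text \<open>Euler's integral for \<open>Gamma\<close> after rescaling the variable by
  \<open>1 / a\<close>.\<close>

lemma nn_integral_powr_exp: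
  assumes x: "x > 0" and a: "(a::real) > 0"
  shows "(\<integral>\<^sup>+t. ennreal (indicator {0<..} t * (t powr (x - 1) * exp (- (a * t)))) \<partial>lborel)
    = ennreal (Gamma x / a powr x)"
proof -
  \<comment> \<open>\<open>0 + 1 / a * t\<close> is the shape left by the affine substitution. The
    indicators of the open and the closed half-line differ only at zero, where \<open>powr\<close>
    has the value zero.\<close>
  have eq: "indicator {0<..} (0 + 1 / a * t) * ((0 + 1 / a * t) powr (x - 1) * exp (- (a * (0 + 1 / a * t))))
      = (1 / a) powr (x - 1) * (indicator {0..} t * t powr (x - 1) / exp t)" for t :: real
  proof (cases "t > 0")
    case True
    then show ?thesis
      using a by (simp add: powr_mult exp_minus field_simps powr_divide)
  next
    case False
    then show ?thesis
      using a by (cases "t = 0") (auto simp: indicator_def zero_less_mult_iff field_simps)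
  qed
  have "(\<integral>\<^sup>+t. ennreal (indicator {0<..} t * (t powr (x - 1) * exp (- (a * t)))) \<partial>lborel)
      = ennreal (1 / a) * (\<integral>\<^sup>+t. ennreal ((1 / a) powr (x - 1) * (indicator {0..} t * t powr (x - 1) / exp t)) \<partial>lborel)"
    using a by (subst nn_integral_real_affine[where c="1 / a" and t=0]) (simp_all only: eq, simp_all)
  also have "\<dots> = ennreal (1 / a) * (ennreal ((1 / a) powr (x - 1)) * ennreal (Gamma x))"
    unfolding Gamma_conv_nn_integral_real[OF x]
    by (subst nn_integral_cmult[of "\<lambda>t. ennreal (indicator {0..} t * t powr (x - 1) / exp t)", symmetric])
      (auto simp: ennreal_mult'[symmetric])
  also have "\<dots> = ennreal (Gamma x / a powr x)"
  proof -
    have "1 / a * ((1 / a) powr (x - 1) * Gamma x) = Gamma x / a powr x"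
      using a by (simp add: powr_divide powr_diff field_simps)
    then show ?thesis
      using a Gamma_real_pos[OF x] by (simp add: ennreal_mult[symmetric])
  qed
  finally show ?thesis .
qed

text \<open>The exponential merges with that of the density and leaves a Gamma integral of rate
  \<open>(1 + a) / 2\<close>. The result is written as an \<open>r\<close>-th power because it is to
  match \<open>r\<close> equal factors, one for each basis vector of an eigenspace.\<close>

lemma expectation_exp_neg_chi_square:
  assumes r: "r > 0" and a: "0 \<le> a"
    and Y: "distributed N lborel Y (\<lambda>x. ennreal (chi_square_density r x))"
  shows "(\<integral>\<omega>. exp (- (a * Y \<omega>) / 2) \<partial>N) = (1 / sqrt (1 + a)) ^ r"
proof -
  define h where "h = real r / 2"
  have h: "h > 0" using r by (simp add: h_def)
  have [measurable]: "Y \<in> borel_measurable N"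
    using distributed_measurable[OF Y] by simp
  have Gamma_pos: "Gamma h > 0" using h by (rule Gamma_real_pos)
  have "(\<integral>\<^sup>+\<omega>. ennreal (exp (- (a * Y \<omega>) / 2)) \<partial>N)
      = (\<integral>\<^sup>+x. ennreal (chi_square_density r x) * ennreal (exp (- (a * x) / 2)) \<partial>lborel)"
    by (rule distributed_nn_integral[OF Y, symmetric]) measurable
  also have "\<dots> = (\<integral>\<^sup>+x. ennreal (1 / (2 powr h * Gamma h)) *
      ennreal (indicator {0<..} x * (x powr (h - 1) * exp (- ((1 + a) / 2 * x)))) \<partial>lborel)"
  proof (rule nn_integral_cong)
    fix x :: real
    have "chi_square_density r x * exp (- (a * x) / 2)
        = 1 / (2 powr h * Gamma h) * (indicator {0<..} x * (x powr (h - 1) * exp (- ((1 + a) / 2 * x))))"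
      by (simp add: chi_square_density_def h_def exp_add[symmetric] field_simps)
    then show "ennreal (chi_square_density r x) * ennreal (exp (- (a * x) / 2))
        = ennreal (1 / (2 powr h * Gamma h)) * ennreal (indicator {0<..} x * (x powr (h - 1) * exp (- ((1 + a) / 2 * x))))"
      using Gamma_pos by (simp only: ennreal_mult'[symmetric] ennreal_mult''[symmetric] exp_ge_zero) (simp add: ennreal_mult'[symmetric])
  qed
  also have "\<dots> = ennreal (1 / (2 powr h * Gamma h)) * ennreal (Gamma h / ((1 + a) / 2) powr h)"
    using a nn_integral_powr_exp[OF h, of "(1 + a) / 2"] by (subst nn_integral_cmult) auto
  also have "\<dots> = ennreal (1 / (1 + a) powr h)"
    using Gamma_pos a by (simp add: ennreal_mult'[symmetric] powr_divide)
  also have "1 / (1 + a) powr h = (1 / sqrt (1 + a)) ^ r"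
    using a by (simp add: h_def powr_half_sqrt[symmetric] powr_powr powr_realpow[symmetric] power_one_over)
  finally show ?thesis
    using a by (subst integral_eq_nn_integral) (auto simp del: power_one_over)
qed

section \<open>Determination of laws on the half-line by Laplace transforms at the integers\<close>

text \<open>Pointwise the truncation is inactive from some \<open>k\<close> on, and dominated
  convergence applies. This removes the cut-off that the polynomial approximation requires.\<close>

lemma expectation_truncation_tendsto:
  fixes W :: "'a \<Rightarrow> real" and g :: "real \<Rightarrow> real"
  assumes L: "prob_space L" and W [measurable]: "W \<in> borel_measurable L"
    and g: "continuous_on UNIV g" "bounded (range g)"
  shows "(\<lambda>k. \<integral>x. g (min (W x) (real k)) \<partial>L) \<longlonglongrightarrow> (\<integral>x. g (W x) \<partial>L)"
proof -
  interpret prob_space L by fact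
  have [measurable]: "g \<in> borel_measurable borel"
    using g(1) by (rule borel_measurable_continuous_onI)
  obtain B where B: "\<And>x. \<bar>g x\<bar> \<le> B"
    using g(2) by (auto simp: bounded_iff)
  show ?thesis
  proof (rule integral_dominated_convergence[where w="\<lambda>_. B"])
    show "AE x in L. (\<lambda>k. g (min (W x) (real k))) \<longlonglongrightarrow> g (W x)"
    proof (rule AE_I2)
      fix x
      obtain k0 where "W x \<le> real k0" using real_arch_simple by blast
      then have "\<forall>\<^sub>F k in sequentially. g (W x) = g (min (W x) (real k))"
        unfolding eventually_sequentially by (metis min.absorb1 of_nat_mono order_trans)
      then show "(\<lambda>k. g (min (W x) (real k))) \<longlonglongrightarrow> g (W x)"
        by (rule Lim_transform_eventually[OF tendsto_const])
    qed
  qed (use B in auto)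
qed

text \<open>The variable \<open>exp (- W x)\<close> lies in the unit interval almost surely, so a
  uniform polynomial approximation there survives integration; its monomials integrate to Laplace
  transforms at integers.\<close>

lemma expectation_polynomial_approx:
  fixes W :: "'a \<Rightarrow> real" and \<phi> :: "real \<Rightarrow> real"
  assumes L: "prob_space L" and W [measurable]: "W \<in> borel_measurable L" and nonneg: "AE x in L. 0 \<le> W x"
    and \<phi> [measurable]: "\<phi> \<in> borel_measurable borel" and B: "\<And>y. \<bar>\<phi> y\<bar> \<le> B"
    and approx: "\<And>y. y \<in> {0..1} \<Longrightarrow> \<bar>\<phi> y - (\<Sum>i\<le>n. a i * y ^ i)\<bar> < \<epsilon>"
  shows "\<bar>(\<integral>x. \<phi> (exp (- W x)) \<partial>L) - (\<Sum>i\<le>n. a i * (\<integral>x. exp (- (real i * W x)) \<partial>L))\<bar> \<le> \<epsilon>"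
proof -
  interpret prob_space L by fact
  have int: "integrable L (\<lambda>x. exp (- (real i * W x)))" for i
    using nonneg by (intro integrable_const_bound[where B=1]) (auto elim!: eventually_mono)
  have int\<phi>: "integrable L (\<lambda>x. \<phi> (exp (- W x)))"
    using B by (intro integrable_const_bound[where B=B]) auto
  let ?p = "\<lambda>x. \<Sum>i\<le>n. a i * exp (- (real i * W x))"
  have "(\<integral>x. \<phi> (exp (- W x)) \<partial>L) - (\<Sum>i\<le>n. a i * (\<integral>x. exp (- (real i * W x)) \<partial>L))
      = (\<integral>x. \<phi> (exp (- W x)) - ?p x \<partial>L)"
    using int int\<phi> by (subst Bochner_Integration.integral_diff) auto
  also have "\<bar>\<dots>\<bar> \<le> (\<integral>x. \<bar>\<phi> (exp (- W x)) - ?p x\<bar> \<partial>L)"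
    by (rule integral_abs_bound)
  also have "\<dots> \<le> (\<integral>x. \<epsilon> \<partial>L)"
  proof (rule integral_mono_AE)
    show "integrable L (\<lambda>x. \<bar>\<phi> (exp (- W x)) - ?p x\<bar>)"
      using int int\<phi> by auto
    show "AE x in L. \<bar>\<phi> (exp (- W x)) - ?p x\<bar> \<le> \<epsilon>"
      using nonneg
    proof eventually_elim
      case (elim x)
      then show ?case
        using approx[of "exp (- W x)"] by (simp add: exp_of_nat_mult[symmetric] less_imp_le)
    qed
  qed simp
  finally show ?thesis by (simp add: prob_space)
qed

text \<open>By the Weierstrass theorem in the variable \<open>exp (- u)\<close>, integer arguments
  of the transform suffice.\<close>

lemma laplace_transform_determines_expectation:
  fixes U :: "'a \<Rightarrow> real" and V :: "'b \<Rightarrow> real" and g :: "real \<Rightarrow> real"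
  assumes M: "prob_space M" and N: "prob_space N"
    and U: "U \<in> borel_measurable M" "AE x in M. 0 \<le> U x"
    and V: "V \<in> borel_measurable N" "AE x in N. 0 \<le> V x"
    and eq: "\<And>k::nat. (\<integral>x. exp (- (real k * U x)) \<partial>M) = (\<integral>x. exp (- (real k * V x)) \<partial>N)"
    and g: "continuous_on UNIV g" "bounded (range g)"
  shows "(\<integral>x. g (U x) \<partial>M) = (\<integral>x. g (V x) \<partial>N)"
proof -
  obtain B where B: "\<And>x. \<bar>g x\<bar> \<le> B"
    using g(2) by (auto simp: bounded_iff)
  \<comment> \<open>Truncating at \<open>K\<close> makes the test function a continuous function of \<open>exp (- U)\<close> on all of \<open>[0, 1]\<close>.\<close>
  have "(\<integral>x. g (min (U x) K) \<partial>M) = (\<integral>x. g (min (V x) K) \<partial>N)" for K :: real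
  proof (rule ccontr)
    assume ne: "(\<integral>x. g (min (U x) K) \<partial>M) \<noteq> (\<integral>x. g (min (V x) K) \<partial>N)"
    define \<phi> where "\<phi> y = g (- ln (max y (exp (- K))))" for y
    have \<phi>: "\<phi> (exp (- u)) = g (min u K)" for u
    proof -
      have "max (exp (- u)) (exp (- K)) = exp (- min u K)"
        by (auto simp: min_def max_def)
      then show ?thesis by (simp add: \<phi>_def)
    qed
    have "max y (exp (- K)) \<noteq> 0" for y :: real
      using less_max_iff_disj[of 0 y "exp (- K)"] by auto
    then have "continuous_on UNIV \<phi>"
      unfolding \<phi>_def by (intro continuous_on_compose2[OF g(1)] continuous_intros) auto
    then have cont: "continuous_on {0..1} \<phi>" and meas: "\<phi> \<in> borel_measurable borel"
      by (auto intro: continuous_on_subset borel_measurable_continuous_onI)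
    have B\<phi>: "\<bar>\<phi> y\<bar> \<le> B" for y
      using B by (simp add: \<phi>_def)
    \<comment> \<open>With a third of the supposed gap as accuracy, the two approximation errors add
      up to at most two thirds of it, a contradiction.\<close>
    define \<epsilon> where "\<epsilon> = \<bar>(\<integral>x. \<phi> (exp (- U x)) \<partial>M) - (\<integral>x. \<phi> (exp (- V x)) \<partial>N)\<bar> / 3"
    have \<epsilon>: "\<epsilon> > 0"
      using ne by (simp add: \<epsilon>_def \<phi>)
    obtain p where p: "real_polynomial_function p" and approx: "\<And>y. y \<in> {0..1} \<Longrightarrow> \<bar>\<phi> y - p y\<bar> < \<epsilon>"
      using Stone_Weierstrass_real_polynomial_function[OF compact_Icc cont \<epsilon>] by metis
    obtain a n where p_eq: "p = (\<lambda>x. \<Sum>i\<le>n. a i * x ^ i)"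
      using p real_polynomial_function_iff_sum by metis
    note approx = approx[unfolded p_eq]
    have "\<bar>(\<integral>x. \<phi> (exp (- U x)) \<partial>M) - (\<integral>x. \<phi> (exp (- V x)) \<partial>N)\<bar> \<le> 2 * \<epsilon>"
      using expectation_polynomial_approx[OF M U meas B\<phi> approx]
        expectation_polynomial_approx[OF N V meas B\<phi> approx] unfolding eq by simp
    with \<epsilon> show False
      unfolding \<epsilon>_def by simp
  qed
  then show ?thesis
    using expectation_truncation_tendsto[OF M U(1) g] expectation_truncation_tendsto[OF N V(1) g]
    by (simp add: LIMSEQ_unique)
qed

section \<open>Law of the squared norm of a Gaussian vector\<close>

text \<open>A characteristic function has modulus at most one. This is the source of the
  nonnegativity of the eigenvalues.\<close>

lemma gaussian_measure_quadratic_form_nonneg: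
  assumes \<mu>: "gaussian_measure S \<mu>"
  shows "0 \<le> t \<bullet> (S *v t)"
proof -
  interpret prob_space \<mu> using \<mu> by (simp add: gaussian_measure_def)
  have "exp (- (t \<bullet> (S *v t)) / 2) = norm (\<integral>x. cis (t \<bullet> x) \<partial>\<mu>)"
    using \<mu> by (simp add: gaussian_measure_def)
  also have "\<dots> \<le> (\<integral>x. norm (cis (t \<bullet> x)) \<partial>\<mu>)"
    by (rule integral_norm_bound)
  also have "\<dots> = 1" by (simp add: prob_space)
  finally show ?thesis by simp
qed

text \<open>Both variables are almost surely nonnegative, and at each integer their Laplace
  transforms equal the same product over an eigenbasis of \<open>S\<close>.\<close>

lemma gaussian_measure_norm_square_law:
  fixes S :: "real^'n^'n" and Y :: "real \<Rightarrow> 'b \<Rightarrow> real" and g :: "real \<Rightarrow> real"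
  assumes \<mu>: "gaussian_measure S \<mu>" and sym: "transpose S = S"
    and N: "prob_space N"
    and indep: "prob_space.indep_vars N (\<lambda>_. borel) Y (nonzero_eigenvalues S)"
    and Y: "\<And>c. c \<in> nonzero_eigenvalues S \<Longrightarrow>
      distributed N lborel (Y c) (\<lambda>x. ennreal (chi_square_density (alg_mult S c) x))"
    and g: "continuous_on UNIV g" "bounded (range g)"
  shows "(\<integral>x. g ((norm x)\<^sup>2) \<partial>\<mu>) = (\<integral>\<omega>. g (\<Sum>c\<in>nonzero_eigenvalues S. c * Y c \<omega>) \<partial>N)"
proof -
  interpret \<mu>: prob_space \<mu> using \<mu> by (simp add: gaussian_measure_def)
  interpret N: prob_space N by fact
  have sets_\<mu> [measurable_cong]: "sets \<mu> = sets borel" using \<mu> by (simp add: gaussian_measure_def)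
  obtain b :: "'n \<Rightarrow> real^'n" and d where b: "\<And>i j. b i \<bullet> b j = (if i = j then 1 else 0)"
    and d: "\<And>i. S *v b i = d i *\<^sub>R b i"
    using symmetric_matrix_eigenbasis[OF sym] by blast
  define E where "E = nonzero_eigenvalues S"
  have E: "E = range d - {0}"
    using eigenvalues_orthonormal_eigenbasis(1)[of b S d] b d by (simp add: E_def)
  have mult: "alg_mult S c = card {i. d i = c}" for c
    using eigenvalues_orthonormal_eigenbasis(2)[of b S d] b d by simp
  have d_nonneg: "0 \<le> d i" for i
    using gaussian_measure_quadratic_form_nonneg[OF \<mu>, of "b i"] by (simp add: d b)
  have finE: "finite E" by (simp add: E)
  have posE: "c > 0" if "c \<in> E" for c
    using that d_nonneg by (auto simp: E less_le)
  have mult_pos: "alg_mult S c > 0" if "c \<in> E" for c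
    using that by (auto simp: E mult card_gt_0_iff)
  have Ym [measurable]: "Y c \<in> borel_measurable N" if "c \<in> E" for c
    using distributed_measurable[OF Y] that by (simp add: E_def)
  have Y_nonneg: "AE \<omega> in N. 0 \<le> Y c \<omega>" if "c \<in> E" for c
  proof -
    have "AE x in density lborel (\<lambda>x. ennreal (chi_square_density (alg_mult S c) x)). 0 \<le> x"
      using Y[of c] that by (subst AE_density) (auto simp: E_def chi_square_density_def distributed_def)
    then have "AE x in distr N lborel (Y c). 0 \<le> x"
      unfolding distributed_distr_eq_density[OF Y[OF that[unfolded E_def]]] .
    then show ?thesis
      using that by (subst (asm) AE_distr_iff) auto
  qed
  have laplace: "(\<integral>x. exp (- (real k * (norm x)\<^sup>2)) \<partial>\<mu>)
      = (\<integral>\<omega>. exp (- (real k * (\<Sum>c\<in>E. c * Y c \<omega>))) \<partial>N)" for k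
  proof -
    \<comment> \<open>The factor 2 offsets the exponent \<open>- s / 2\<close> in the transform
      formulas.\<close>
    define s where "s = 2 * real k"
    have s: "s \<ge> 0" by (simp add: s_def)
    have int: "integrable N (\<lambda>\<omega>. exp (- (s * c * Y c \<omega>) / 2))" if "c \<in> E" for c
      using Y_nonneg[OF that] posE[OF that] s that
      by (intro N.integrable_const_bound[where B=1]) (auto elim!: eventually_mono)
    have "(\<integral>\<omega>. exp (- (real k * (\<Sum>c\<in>E. c * Y c \<omega>))) \<partial>N)
        = (\<integral>\<omega>. (\<Prod>c\<in>E. exp (- (s * c * Y c \<omega>) / 2)) \<partial>N)"
      using finE by (simp add: exp_sum[symmetric] s_def sum_distrib_left sum_negf mult_ac)
    also have "\<dots> = (\<Prod>c\<in>E. \<integral>\<omega>. exp (- (s * c * Y c \<omega>) / 2) \<partial>N)"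
      using int finE N.indep_vars_compose2[OF indep, of "\<lambda>c y. exp (- (s * c * y) / 2)" "\<lambda>_. borel"]
      by (intro N.indep_vars_lebesgue_integral) (auto simp: E_def)
    also have "\<dots> = (\<Prod>c\<in>E. (1 / sqrt (1 + s * c)) ^ card {i. d i = c})"
      unfolding mult[symmetric] using posE s mult_pos Y
      by (intro prod.cong refl expectation_exp_neg_chi_square) (auto simp: E_def less_imp_le)
    \<comment> \<open>The value \<open>c = 0\<close> may be added since its factor is one; splitting
      each power over the fibre of \<open>d\<close> then gives a product over all indices.\<close>
    also have "\<dots> = (\<Prod>c\<in>range d. (1 / sqrt (1 + s * c)) ^ card {i. d i = c})"
      unfolding E by (rule prod.mono_neutral_left) auto
    also have "\<dots> = (\<Prod>c\<in>range d. \<Prod>i | i \<in> UNIV \<and> d i = c. 1 / sqrt (1 + s * d i))"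
      by (intro prod.cong refl) (simp del: power_one_over)
    also have "\<dots> = (\<Prod>i\<in>UNIV. 1 / sqrt (1 + s * d i))"
      by (rule prod.image_gen[symmetric]) simp
    also have "\<dots> = (\<integral>x. exp (- (s * (norm x)\<^sup>2) / 2) \<partial>\<mu>)"
      using gaussian_measure_laplace_norm_square[OF \<mu>, of b d s] b d d_nonneg s by simp
    finally show ?thesis by (simp add: s_def)
  qed
  have "AE \<omega> in N. \<forall>c\<in>E. 0 \<le> Y c \<omega>"
    using Y_nonneg finE by (simp add: AE_finite_all)
  then have nonneg: "AE \<omega> in N. 0 \<le> (\<Sum>c\<in>E. c * Y c \<omega>)"
    using posE by (auto elim!: eventually_mono intro!: sum_nonneg simp: less_imp_le)
  have "(\<integral>x. g ((norm x)\<^sup>2) \<partial>\<mu>) = (\<integral>\<omega>. g (\<Sum>c\<in>E. c * Y c \<omega>) \<partial>N)"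
    by (rule laplace_transform_determines_expectation
        [OF \<mu>.prob_space_axioms N _ _ _ nonneg laplace g]) auto
  then show ?thesis by (simp add: E_def)
qed

section \<open>Extended continuous mapping\<close>

lemma uniform_limit_sum:
  fixes f :: "'i \<Rightarrow> 'a \<Rightarrow> 'b \<Rightarrow> 'c::real_normed_vector"
  assumes "\<And>i. i \<in> I \<Longrightarrow> uniform_limit X (f i) (l i) F"
  shows "uniform_limit X (\<lambda>n x. \<Sum>i\<in>I. f i n x) (\<lambda>x. \<Sum>i\<in>I. l i x) F"
  using assms
  by (induction I rule: infinite_finite_induct) (auto intro!: uniform_limit_intros)

lemma uniform_limit_Pair:
  assumes f: "uniform_limit X f l F" and g: "uniform_limit X g m F"
  shows "uniform_limit X (\<lambda>n x. (f n x, g n x)) (\<lambda>x. (l x, m x)) F"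
proof (rule uniform_limitI)
  fix e :: real assume "e > 0"
  then have "e / 2 > 0" by simp
  from uniform_limitD[OF f this] uniform_limitD[OF g this]
  show "\<forall>\<^sub>F n in F. \<forall>x\<in>X. dist (f n x, g n x) (l x, m x) < e"
  proof eventually_elim
    case (elim n)
    show ?case
    proof
      fix x assume "x \<in> X"
      have "dist (f n x, g n x) (l x, m x) \<le> dist (f n x) (l x) + dist (g n x) (m x)"
        by (simp add: dist_Pair_Pair sqrt_sum_squares_le_sum)
      also have "\<dots> < e"
        using elim \<open>x \<in> X\<close> by (auto simp: field_sum_of_halves dest!: bspec[of X _ x])
      finally show "dist (f n x, g n x) (l x, m x) < e" .
    qed
  qed
qed

text \<open>The map \<open>Gn n\<close> varies with \<open>n\<close>, so plain continuous mapping
  does not apply. Weak convergence bounds the mass of \<open>Z n\<close> outside a large ball, and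
  inside it \<open>Gn n\<close> may be replaced by \<open>G\<close> with small uniform
  error.\<close>

lemma conv_distr_uniform_limit:
  fixes Z :: "nat \<Rightarrow> 'a \<Rightarrow> 'b::euclidean_space" and W :: "nat \<Rightarrow> 'a \<Rightarrow> 'c::euclidean_space"
    and G :: "'b \<Rightarrow> 'c" and g :: "'c \<Rightarrow> real"
  assumes M: "prob_space M" and \<mu>: "prob_space \<mu>" "sets \<mu> = sets borel"
    and Z [measurable]: "\<And>n. Z n \<in> borel_measurable M" and W [measurable]: "\<And>n. W n \<in> borel_measurable M"
    and conv: "conv_distr M Z \<mu>"
    and G: "continuous_on UNIV G"
    and lim: "\<And>R. uniform_limit (cball 0 R) Gn G sequentially"
    and W_eq: "\<forall>\<^sub>F n in sequentially. \<forall>\<omega>\<in>space M. W n \<omega> = Gn n (Z n \<omega>)"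
    and g: "continuous_on UNIV g" "bounded (range g)"
  shows "(\<lambda>n. \<integral>\<omega>. g (W n \<omega>) \<partial>M) \<longlonglongrightarrow> (\<integral>x. g (G x) \<partial>\<mu>)"
proof -
  interpret M: prob_space M by fact
  interpret \<mu>: prob_space \<mu> by fact
  note [measurable_cong] = \<mu>(2)
  have [measurable]: "g \<in> borel_measurable borel" "G \<in> borel_measurable borel"
    using g(1) G by (auto intro: borel_measurable_continuous_onI)
  obtain B where B: "\<And>x. \<bar>g x\<bar> \<le> B"
    using g(2) by (auto simp: bounded_iff)
  have "B \<ge> 0" using B[of 0] by linarith
  have gG: "continuous_on UNIV (\<lambda>x. g (G x))" "bounded (range (\<lambda>x. g (G x)))"
    using B by (auto intro: continuous_on_compose2[OF g(1) G] simp: bounded_iff)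
  \<comment> \<open>A continuous substitute for the indicator of a ball: one up to radius
    \<open>R\<close>, zero from radius \<open>R + 1\<close> on. Being a valid test function, it
    carries tightness from \<open>\<mu>\<close> over to \<open>Z n\<close>.\<close>
  define cut where "cut R x = max 0 (min 1 (R + 1 - norm x))" for R and x :: 'b
  have cut: "0 \<le> cut R x" "cut R x \<le> 1" for R x
    by (auto simp: cut_def)
  have cut_cont: "continuous_on UNIV (cut R)" for R
    unfolding cut_def by (intro continuous_intros)
  then have [measurable]: "cut R \<in> borel_measurable borel" for R
    by (rule borel_measurable_continuous_onI)
  have cut_lim: "(\<lambda>k. \<integral>x. cut (real k) x \<partial>\<mu>) \<longlonglongrightarrow> (\<integral>x. 1 \<partial>\<mu>)"
  proof (rule integral_dominated_convergence[where w="\<lambda>_. 1"])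
    show "AE x in \<mu>. (\<lambda>k. cut (real k) x) \<longlonglongrightarrow> 1"
    proof (rule AE_I2)
      fix x :: 'b
      obtain k0 where "norm x \<le> real k0" using real_arch_simple by blast
      then have "cut (real k) x = 1" if "k \<ge> k0" for k
        using that of_nat_mono[OF that, where 'a=real] unfolding cut_def by simp
      then have "\<forall>\<^sub>F k in sequentially. 1 = cut (real k) x"
        unfolding eventually_sequentially by metis
      then show "(\<lambda>k. cut (real k) x) \<longlonglongrightarrow> 1"
        by (rule Lim_transform_eventually[OF tendsto_const])
    qed
  qed (use cut in auto)
  have "(\<lambda>n. (\<integral>\<omega>. g (W n \<omega>) \<partial>M) - (\<integral>\<omega>. g (G (Z n \<omega>)) \<partial>M)) \<longlonglongrightarrow> 0"
  proof (rule LIMSEQ_I)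
    fix r :: real assume "r > 0"
    \<comment> \<open>The final error is \<open>\<epsilon> + 2 * B * \<epsilon>\<close>; the
      additional \<open>\<epsilon>\<close> in \<open>r\<close> makes the inequality strict.\<close>
    define \<epsilon> where "\<epsilon> = r / (2 + 2 * B)"
    have "\<epsilon> > 0" "r = \<epsilon> * (2 + 2 * B)"
      using \<open>r > 0\<close> \<open>B \<ge> 0\<close> by (auto simp: \<epsilon>_def)
    then have \<epsilon>: "\<epsilon> > 0" "\<epsilon> + 2 * B * \<epsilon> < r"
      by (simp_all add: algebra_simps)
    have "\<forall>\<^sub>F k in sequentially. (\<integral>x. cut (real k) x \<partial>\<mu>) > 1 - \<epsilon>"
      using \<epsilon>(1) cut_lim by (intro order_tendstoD) (auto simp: \<mu>.prob_space)
    then obtain k where k: "(\<integral>x. cut (real k) x \<partial>\<mu>) > 1 - \<epsilon>"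
      by (auto dest: eventually_happens)
    define R where "R = real k"
    have "bounded (range (cut R))"
      using cut by (auto simp: bounded_iff intro!: exI[of _ 1])
    then have "(\<lambda>n. \<integral>\<omega>. cut R (Z n \<omega>) \<partial>M) \<longlonglongrightarrow> (\<integral>x. cut R x \<partial>\<mu>)"
      using conv cut_cont unfolding conv_distr_def by blast
    then have ev1: "\<forall>\<^sub>F n in sequentially. (\<integral>\<omega>. cut R (Z n \<omega>) \<partial>M) > 1 - \<epsilon>"
      using k unfolding R_def by (rule order_tendstoD)
    define C where "C = cball (0::'b) (R + 1)"
    have "compact (G ` C)"
      unfolding C_def by (intro compact_continuous_image continuous_on_subset[OF G]) auto
    then obtain B' where B': "\<And>x. x \<in> C \<Longrightarrow> norm (G x) \<le> B'"
      by (meson compact_imp_bounded bounded_iff imageI)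
    \<comment> \<open>\<open>g\<close> is known to be uniformly continuous only on compact sets. The
      margin 1 keeps the values of \<open>Gn n\<close> on \<open>C\<close> in this ball once they
      are within distance 1 of those of \<open>G\<close>.\<close>
    have unif: "uniformly_continuous_on (cball 0 (B' + 1)) g"
      by (intro compact_uniformly_continuous continuous_on_subset[OF g(1)]) auto
    have "\<forall>\<^sub>F n in sequentially. \<forall>x\<in>C. dist (Gn n x) (G x) < 1"
      using lim[of "R + 1"] unfolding C_def by (rule uniform_limitD) simp
    then have ev2: "\<forall>\<^sub>F n in sequentially. \<forall>x\<in>C. Gn n x \<in> cball 0 (B' + 1)"
    proof (rule eventually_mono, safe)
      fix n x assume "\<forall>x\<in>C. dist (Gn n x) (G x) < 1" "x \<in> C"
      then show "Gn n x \<in> cball 0 (B' + 1)"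
        using B'[of x] norm_triangle_ineq2[of "Gn n x" "G x"] by (force simp: dist_norm)
    qed
    have "uniform_limit C (\<lambda>n x. g (Gn n x)) (\<lambda>x. g (G x)) sequentially"
      by (rule uniform_limit_compose_uniformly_continuous_on[OF lim[of "R + 1", folded C_def] unif ev2]) simp
    from uniform_limitD[OF this \<epsilon>(1)] ev1 W_eq
    have "\<forall>\<^sub>F n in sequentially. norm ((\<integral>\<omega>. g (W n \<omega>) \<partial>M) - (\<integral>\<omega>. g (G (Z n \<omega>)) \<partial>M) - 0) < r"
    proof eventually_elim
      case (elim n)
      have int: "integrable M (\<lambda>\<omega>. g (W n \<omega>))" "integrable M (\<lambda>\<omega>. g (G (Z n \<omega>)))"
        using B by (auto intro!: M.integrable_const_bound[where B=B])
      have intc: "integrable M (\<lambda>\<omega>. cut R (Z n \<omega>))"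
        using cut by (auto intro!: M.integrable_const_bound[where B=1])
      have "\<bar>(\<integral>\<omega>. g (W n \<omega>) \<partial>M) - (\<integral>\<omega>. g (G (Z n \<omega>)) \<partial>M)\<bar>
          = \<bar>\<integral>\<omega>. g (W n \<omega>) - g (G (Z n \<omega>)) \<partial>M\<bar>"
        using int by simp
      also have "\<dots> \<le> (\<integral>\<omega>. \<bar>g (W n \<omega>) - g (G (Z n \<omega>))\<bar> \<partial>M)"
        by (rule integral_abs_bound)
      \<comment> \<open>On \<open>C\<close> the term \<open>\<epsilon>\<close> suffices; off
        \<open>C\<close> the cut-off vanishes and the trivial bound \<open>2 * B\<close> takes
        over.\<close>
      also have "\<dots> \<le> (\<integral>\<omega>. \<epsilon> + 2 * B * (1 - cut R (Z n \<omega>)) \<partial>M)"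
      proof (rule integral_mono)
        show "integrable M (\<lambda>\<omega>. \<bar>g (W n \<omega>) - g (G (Z n \<omega>))\<bar>)"
          using int by auto
        show "integrable M (\<lambda>\<omega>. \<epsilon> + 2 * B * (1 - cut R (Z n \<omega>)))"
          using intc by auto
        fix \<omega> assume \<omega>: "\<omega> \<in> space M"
        show "\<bar>g (W n \<omega>) - g (G (Z n \<omega>))\<bar> \<le> \<epsilon> + 2 * B * (1 - cut R (Z n \<omega>))"
        proof (cases "Z n \<omega> \<in> C")
          case True
          then have "\<bar>g (W n \<omega>) - g (G (Z n \<omega>))\<bar> < \<epsilon>"
            using elim \<omega> by (auto simp: dist_real_def)
          moreover have "0 \<le> 2 * B * (1 - cut R (Z n \<omega>))"
            using cut \<open>B \<ge> 0\<close> by simp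
          ultimately show ?thesis by linarith
        next
          case False
          then have "cut R (Z n \<omega>) = 0"
            by (simp add: C_def cut_def)
          then show ?thesis
            using B[of "W n \<omega>"] B[of "G (Z n \<omega>)"] \<epsilon>(1) by simp
        qed
      qed
      also have "\<dots> = \<epsilon> + 2 * B * (1 - (\<integral>\<omega>. cut R (Z n \<omega>) \<partial>M))"
        using intc by (simp add: M.prob_space)
      also have "\<dots> \<le> \<epsilon> + 2 * B * \<epsilon>"
        using elim \<open>B \<ge> 0\<close> by (intro add_left_mono mult_left_mono) auto
      also have "\<dots> < r" by (rule \<epsilon>)
      finally show ?case by simp
    qed
    then show "\<exists>no. \<forall>n\<ge>no. norm ((\<integral>\<omega>. g (W n \<omega>) \<partial>M) - (\<integral>\<omega>. g (G (Z n \<omega>)) \<partial>M) - 0) < r"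
      by (simp add: eventually_sequentially)
  qed
  moreover have "(\<lambda>n. \<integral>\<omega>. g (G (Z n \<omega>)) \<partial>M) \<longlonglongrightarrow> (\<integral>x. g (G x) \<partial>\<mu>)"
    using conv gG unfolding conv_distr_def by blast
  ultimately show ?thesis
    using tendsto_add by fastforce
qed

section \<open>Ordinal patterns\<close>

text \<open>Ranks are taken in the lexicographic order of value and index, which is strict and total
  on positions. They therefore increase strictly, and an injective self-map of a finite set is a
  bijection.\<close>

lemma ordpat_permutes: "ordpat m x permutes {..<m}"
proof -
  define below where "below i = {j. j < m \<and> (x j < x i \<or> (x j = x i \<and> j < i))}" for i
  have rank: "ordpat m x i = card (below i)" if "i < m" for i
    using that by (simp add: ordpat_def below_def)
  have fin: "finite (below i)" for i
    by (simp add: below_def)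
  have less: "card (below i) < card (below j)" if "i < m" "x i < x j \<or> (x i = x j \<and> i < j)" for i j
  proof (rule psubset_card_mono[OF fin])
    have "i \<in> below j" "i \<notin> below i" "below i \<subseteq> below j"
      using that by (auto simp: below_def)
    then show "below i \<subset> below j" by blast
  qed
  have "inj_on (ordpat m x) {..<m}"
  proof (rule inj_onI)
    fix i j assume "i \<in> {..<m}" "j \<in> {..<m}" "ordpat m x i = ordpat m x j"
    then show "i = j"
      using less[of i j] less[of j i] rank[of i] rank[of j] by (cases "x i < x j"; cases "x j < x i"; cases i j rule: linorder_cases) auto
  qed
  moreover have "ordpat m x ` {..<m} \<subseteq> {..<m}"
  proof safe
    fix i assume "i < m"
    have "card (below i) < card {..<m}"
      using \<open>i < m\<close> by (intro psubset_card_mono) (auto simp: below_def)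
    then show "ordpat m x i < m"
      using \<open>i < m\<close> by (simp add: rank)
  qed
  ultimately have "bij_betw (ordpat m x) {..<m} {..<m}"
    by (simp add: bij_betw_def endo_inj_surj)
  then show ?thesis
    by (rule bij_imp_permutes) (simp add: ordpat_def)
qed

text \<open>Writing the rank as a finite sum of indicators of comparisons reduces the event to
  countably many measurable conditions.\<close>

lemma ordpat_event_measurable:
  assumes [measurable]: "\<And>t. X t \<in> borel_measurable M"
  shows "Measurable.pred M (\<lambda>\<omega>. ordpat m (\<lambda>i. X (t + i) \<omega>) = \<pi>)"
proof -
  have card_eq: "card {j. j < m \<and> P j} = (\<Sum>j<m. if P j then 1 else 0)" for P :: "nat \<Rightarrow> bool"
    by (simp add: sum.If_cases card_eq_sum[symmetric] Collect_conj_eq lessThan_def)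
  have "(\<lambda>\<omega>. ordpat m (\<lambda>i. X (t + i) \<omega>) = \<pi>) = (\<lambda>\<omega>. \<forall>i. (if i < m then (\<Sum>j<m.
      if X (t + j) \<omega> < X (t + i) \<omega> \<or> (X (t + j) \<omega> = X (t + i) \<omega> \<and> j < i) then 1 else 0) else i) = \<pi> i)"
    by (simp add: ordpat_def card_eq fun_eq_iff)
  also have "Measurable.pred M \<dots>"
    by measurable
  finally show ?thesis .
qed

section \<open>Quadratic expansion of the entropy\<close>

text \<open>The summand \<open>1 - y\<close> cancels the linear term of \<open>y ln y\<close> at 1 and sums to zero on the simplex.\<close>

definition relent :: "real \<Rightarrow> real" where
  "relent y = y * ln y - y + 1"

text \<open>Second-order Taylor expansion at 1. An error proportional to \<open>x\<^sup>2\<close>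
  also covers \<open>x = 0\<close> and scales like the main term.\<close>

lemma relent_quadratic:
  assumes "\<epsilon> > 0"
  obtains \<delta> where "\<delta> > 0" "\<And>x. \<bar>x\<bar> < \<delta> \<Longrightarrow> \<bar>relent (1 + x) - x\<^sup>2 / 2\<bar> \<le> \<epsilon> * x\<^sup>2"
proof -
  have "((\<lambda>x. relent (1 + x) / x\<^sup>2) \<longlongrightarrow> 1 / 2) (at 0)"
    unfolding relent_def by real_asymp
  then obtain \<delta> where "\<delta> > 0" and \<delta>: "\<And>x. x \<noteq> 0 \<Longrightarrow> \<bar>x\<bar> < \<delta> \<Longrightarrow> \<bar>relent (1 + x) / x\<^sup>2 - 1 / 2\<bar> < \<epsilon>"
    using LIM_D[OF _ assms] by (metis (no_types, lifting) diff_zero real_norm_def)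
  have "\<bar>relent (1 + x) - x\<^sup>2 / 2\<bar> \<le> \<epsilon> * x\<^sup>2" if "\<bar>x\<bar> < \<delta>" for x
  proof (cases "x = 0")
    case True
    then show ?thesis by (simp add: relent_def)
  next
    case False
    have "\<bar>relent (1 + x) - x\<^sup>2 / 2\<bar> = \<bar>relent (1 + x) / x\<^sup>2 - 1 / 2\<bar> * x\<^sup>2"
      using False by (simp add: field_simps abs_divide flip: abs_mult[of _ "x\<^sup>2", simplified])
    also have "\<dots> \<le> \<epsilon> * x\<^sup>2"
      using \<delta>[OF False that] by (intro mult_right_mono) auto
    finally show ?thesis .
  qed
  with \<open>\<delta> > 0\<close> that show thesis by blast
qed

text \<open>With \<open>x = a * y / sqrt n\<close>, the scaled error
  \<open>n * \<epsilon> * x\<^sup>2\<close> equals \<open>\<epsilon> * (a * y)\<^sup>2\<close>,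
  which is free of \<open>n\<close> and bounded on the interval.\<close>

lemma relent_scaled_uniform_limit:
  "uniform_limit {-R..R} (\<lambda>n y. real n * relent (1 + a * y / sqrt (real n))) (\<lambda>y. a\<^sup>2 * y\<^sup>2 / 2) sequentially"
proof (rule uniform_limitI)
  fix e :: real assume "e > 0"
  define B where "B = \<bar>a\<bar> * \<bar>R\<bar>"
  \<comment> \<open>Chosen so that \<open>\<epsilon> * B\<^sup>2 < e\<close>, also when
    \<open>B = 0\<close>.\<close>
  define \<epsilon> where "\<epsilon> = e / (B\<^sup>2 + 1)"
  have B: "B\<^sup>2 + 1 > 0" by (rule add_nonneg_pos) auto
  have "\<epsilon> > 0" using \<open>e > 0\<close> B by (simp add: \<epsilon>_def)
  then obtain \<delta> where "\<delta> > 0" and \<delta>: "\<And>x. \<bar>x\<bar> < \<delta> \<Longrightarrow> \<bar>relent (1 + x) - x\<^sup>2 / 2\<bar> \<le> \<epsilon> * x\<^sup>2"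
    using relent_quadratic by blast
  have "(\<lambda>n. B / sqrt (real n)) \<longlonglongrightarrow> 0"
    by real_asymp
  then have "\<forall>\<^sub>F n in sequentially. B / sqrt (real n) < \<delta>"
    using \<open>\<delta> > 0\<close> by (rule order_tendstoD)
  then show "\<forall>\<^sub>F n in sequentially. \<forall>y\<in>{-R..R}.
      dist (real n * relent (1 + a * y / sqrt (real n))) (a\<^sup>2 * y\<^sup>2 / 2) < e"
    using eventually_gt_at_top[of 0]
  proof eventually_elim
    case (elim n)
    show ?case
    proof
      fix y assume y: "y \<in> {-R..R}"
      define x where "x = a * y / sqrt (real n)"
      have ay: "\<bar>a * y\<bar> \<le> B"
        using y by (auto simp: B_def abs_mult intro!: mult_left_mono)
      then have "\<bar>x\<bar> \<le> B / sqrt (real n)"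
        by (simp add: x_def abs_divide divide_right_mono)
      with elim have "\<bar>relent (1 + x) - x\<^sup>2 / 2\<bar> \<le> \<epsilon> * x\<^sup>2"
        by (intro \<delta>) simp
      have nx: "real n * x\<^sup>2 = (a * y)\<^sup>2"
        using elim by (simp add: x_def power_divide)
      have "\<bar>real n * relent (1 + x) - a\<^sup>2 * y\<^sup>2 / 2\<bar> = \<bar>real n * (relent (1 + x) - x\<^sup>2 / 2)\<bar>"
        using nx by (simp add: right_diff_distrib power_mult_distrib)
      also have "\<dots> = real n * \<bar>relent (1 + x) - x\<^sup>2 / 2\<bar>"
        by (simp add: abs_mult)
      also have "\<dots> \<le> real n * (\<epsilon> * x\<^sup>2)"
        by (intro mult_left_mono) (fact, simp)
      also have "\<dots> = \<epsilon> * (a * y)\<^sup>2"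
        by (simp add: nx[symmetric])
      also have "\<dots> \<le> \<epsilon> * B\<^sup>2"
        using \<open>\<epsilon> > 0\<close> ay by (intro mult_left_mono) (simp_all add: abs_le_square_iff[symmetric])
      also have "\<dots> < e"
        using \<open>e > 0\<close> B by (simp add: \<epsilon>_def field_simps)
      finally show "dist (real n * relent (1 + a * y / sqrt (real n))) (a\<^sup>2 * y\<^sup>2 / 2) < e"
        by (simp add: dist_real_def x_def)
    qed
  qed
qed

lemma sum_relent_scaled_uniform_limit:
  "uniform_limit (cball 0 R) (\<lambda>n z::real^'k. \<Sum>k\<in>UNIV. real n * relent (1 + a * z $ k / sqrt (real n)))
    (\<lambda>z. a\<^sup>2 / 2 * (norm z)\<^sup>2) sequentially"
proof -
  have "uniform_limit (cball 0 R) (\<lambda>n z::real^'k. \<Sum>k\<in>UNIV. real n * relent (1 + a * z $ k / sqrt (real n)))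
    (\<lambda>z. \<Sum>k\<in>UNIV. a\<^sup>2 * (z $ k)\<^sup>2 / 2) sequentially"
  proof (rule uniform_limit_sum)
    fix k :: 'k
    have "(\<lambda>z::real^'k. z $ k) \<in> cball 0 R \<rightarrow> {-R..R}"
    proof
      fix z :: "real^'k" assume "z \<in> cball 0 R"
      then show "z $ k \<in> {-R..R}"
        using component_le_norm_cart[of z k] by auto
    qed
    from uniform_limit_compose'[OF relent_scaled_uniform_limit this]
    show "uniform_limit (cball 0 R) (\<lambda>n z::real^'k. real n * relent (1 + a * z $ k / sqrt (real n)))
      (\<lambda>z. a\<^sup>2 * (z $ k)\<^sup>2 / 2) sequentially" .
  qed
  moreover have "(\<Sum>k\<in>UNIV. a\<^sup>2 * (z $ k)\<^sup>2 / 2) = a\<^sup>2 / 2 * (norm z)\<^sup>2" for z :: "real^'k"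
    unfolding power2_norm_eq_inner inner_vec_def by (simp add: sum_distrib_left power2_eq_square)
  ultimately show ?thesis by simp
qed

text \<open>The subtracted average is the relative entropy of \<open>q\<close> with respect to the
  uniform distribution: the linear terms of \<open>relent\<close> cancel because \<open>q\<close>
  sums to one.\<close>

lemma shannon_eq_relent:
  fixes q :: "real^'k"
  assumes nonneg: "\<And>k. 0 \<le> q $ k" and sum: "(\<Sum>k\<in>UNIV. q $ k) = 1"
  shows "shannon q = ln (CARD('k)) - (\<Sum>k\<in>UNIV. relent (CARD('k) * q $ k)) / CARD('k)"
proof -
  define K where "K = real CARD('k)"
  have K: "K > 0" by (simp add: K_def)
  have "(if q $ k = 0 then 0 else q $ k * ln (q $ k))
      = relent (K * q $ k) / K + q $ k - 1 / K - q $ k * ln K" for k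
    using nonneg[of k] K by (simp add: relent_def ln_mult field_simps)
  then have "shannon q = - ((\<Sum>k\<in>UNIV. relent (K * q $ k) / K) + (\<Sum>k\<in>UNIV. q $ k)
      - (\<Sum>k\<in>(UNIV::'k set). 1 / K) - (\<Sum>k\<in>UNIV. q $ k * ln K))"
    by (simp add: shannon_def sum.distrib sum_subtractf)
  also have "\<dots> = ln K - (\<Sum>k\<in>UNIV. relent (K * q $ k)) / K"
    using K by (simp add: sum sum_divide_distrib[symmetric] sum_distrib_right[symmetric] K_def)
  finally show ?thesis by (simp add: K_def)
qed

text \<open>The midpoint of \<open>q\<close> and the uniform vector is again a probability vector,
  so the entropy formula applies to both, and the three logarithmic constants cancel.\<close>

lemma disequilibrium_eq_relent:
  fixes q :: "real^'k"
  assumes nonneg: "\<And>k. 0 \<le> q $ k" and sum: "(\<Sum>k\<in>UNIV. q $ k) = 1" and card: "CARD('k) = fact m"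
  shows "disequilibrium m q = (\<Sum>k\<in>UNIV. relent (fact m * q $ k)) / (2 * fact m)
    - (\<Sum>k\<in>UNIV. relent ((fact m * q $ k + 1) / 2)) / fact m"
proof -
  define r :: "real^'k" where "r = (1/2) *\<^sub>R (q + unif m)"
  have K: "real CARD('k) = fact m" by (simp add: card)
  have r: "r $ k = (q $ k + 1 / fact m) / 2" for k
    by (simp add: r_def unif_def)
  have "(\<Sum>k\<in>UNIV. r $ k) = 1"
    using card by (simp add: r sum_divide_distrib[symmetric] sum.distrib sum)
  then have "shannon r = ln (fact m) - (\<Sum>k\<in>UNIV. relent (fact m * r $ k)) / fact m"
    using shannon_eq_relent[of r] nonneg by (simp add: r K)
  moreover have "fact m * r $ k = (fact m * q $ k + 1) / 2" for k
    by (simp add: r field_simps)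
  ultimately show ?thesis
    using shannon_eq_relent[OF nonneg sum]
    by (simp add: disequilibrium_def r_def[symmetric] K field_simps)
qed

section \<open>The limit theorem\<close>

theorem theorem4p7:
  fixes M :: "'a measure"
    and X :: "nat \<Rightarrow> 'a \<Rightarrow> real"
    and m :: nat
    and pat :: "'k::finite \<Rightarrow> (nat \<Rightarrow> nat)"
    and OP :: "nat \<Rightarrow> 'a \<Rightarrow> (nat \<Rightarrow> nat)"
    and p :: "real^'k"
    and phat :: "nat \<Rightarrow> 'a \<Rightarrow> real^'k"
    and pij :: "'k \<Rightarrow> 'k \<Rightarrow> nat \<Rightarrow> real"
    and Sigma :: "real^'k^'k"
  assumes M: "prob_space M"
    and X_meas: "\<And>t. X t \<in> borel_measurable M"
    and m: "m \<ge> 2"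
    and card_k: "CARD('k) = fact m"
    and pat: "bij_betw pat UNIV {\<pi>. \<pi> permutes {..<m}}"
    and OP_def: "OP = (\<lambda>t \<omega>. ordpat m (\<lambda>i. X (t + i) \<omega>))"
    and stationary: "\<And>s n (f :: nat \<Rightarrow> nat \<Rightarrow> nat).
          measure M {\<omega> \<in> space M. \<forall>t<n. OP (t + s) \<omega> = f t}
        = measure M {\<omega> \<in> space M. \<forall>t<n. OP t \<omega> = f t}"
    and p_def: "p = (\<chi> i. measure M {\<omega> \<in> space M. OP 0 \<omega> = pat i})"
    and phat_def: "phat = (\<lambda>n \<omega>. \<chi> i. (1 / real n) *
          (\<Sum>t\<in>{1..n}. if OP t \<omega> = pat i then 1 else 0))"
    and pij_def: "pij = (\<lambda>i j k. measure M {\<omega> \<in> space M. OP 0 \<omega> = pat i \<and> OP k \<omega> = pat j})"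
    and abs_conv: "\<And>i j. summable (\<lambda>k. \<bar>pij i j (Suc k) + pij j i (Suc k) - 2 * p$i * p$j\<bar>)"
    and Sigma_def: "Sigma = (\<chi> i j. p$i * ((if i = j then 1 else 0) - p$j)
          + (\<Sum>k. pij i j (Suc k) + pij j i (Suc k) - 2 * p$i * p$j))"
    and A: "\<exists>\<mu>. gaussian_measure Sigma \<mu> \<and>
          conv_distr M (\<lambda>n \<omega>. sqrt (real n) *\<^sub>R (phat n \<omega> - p)) \<mu>"
    and p_unif: "p = unif m"
  shows "\<forall>(N :: 'b measure) (Y :: real \<Rightarrow> 'b \<Rightarrow> real).
     prob_space N \<longrightarrow>
     prob_space.indep_vars N (\<lambda>_. borel) Y (nonzero_eigenvalues Sigma) \<longrightarrow>
     (\<forall>c\<in>nonzero_eigenvalues Sigma.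
        distributed N lborel (Y c) (\<lambda>x. ennreal (chi_square_density (alg_mult Sigma c) x))) \<longrightarrow>
     conv_distr M
       (\<lambda>n \<omega>. (real n * (shannon (phat n \<omega>) / ln (fact m) - 1),
                 real n * complexity m (phat n \<omega>)))
       (distr N borel (\<lambda>\<omega>. let Q = (\<Sum>c\<in>nonzero_eigenvalues Sigma. c * Y c \<omega>) in
          (- (fact m / (2 * ln (fact m))) * Q, fact m / 8 * D0 m * Q)))"
proof (intro allI impI)
  fix N :: "'b measure" and Y :: "real \<Rightarrow> 'b \<Rightarrow> real"
  assume N: "prob_space N"
    and indep: "prob_space.indep_vars N (\<lambda>_. borel) Y (nonzero_eigenvalues Sigma)"
    and Y: "\<forall>c\<in>nonzero_eigenvalues Sigma.
        distributed N lborel (Y c) (\<lambda>x. ennreal (chi_square_density (alg_mult Sigma c) x))"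
  obtain \<mu> where \<mu>: "gaussian_measure Sigma \<mu>"
    and conv: "conv_distr M (\<lambda>n \<omega>. sqrt (real n) *\<^sub>R (phat n \<omega> - p)) \<mu>"
    using A by blast
  define K :: real where "K = fact m"
  define \<Lambda> where "\<Lambda> = ln K"
  have "(2::real) \<le> fact m"
    using fact_mono[OF m, where 'a=real] by (simp add: numeral_2_eq_2)
  then have K: "K > 1" "\<Lambda> > 0" by (auto simp: K_def \<Lambda>_def)
  have card: "real CARD('k) = K" by (simp add: card_k K_def)
  define Z where "Z = (\<lambda>n \<omega>. sqrt (real n) *\<^sub>R (phat n \<omega> - p))"

  \<comment> \<open>Empirical frequencies as random points of the simplex\<close>
  have OP_meas [measurable]: "Measurable.pred M (\<lambda>\<omega>. OP t \<omega> = \<pi>)" for t \<pi>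
    unfolding OP_def by (rule ordpat_event_measurable) (rule X_meas)
  have phat_k [measurable]: "(\<lambda>\<omega>. phat n \<omega> $ k) \<in> borel_measurable M" for n k
    by (simp add: phat_def)
  have phat_meas [measurable]: "phat n \<in> borel_measurable M" for n
    by (subst borel_measurable_euclidean_space) (auto simp: Basis_vec_def inner_axis)
  have phat_nonneg: "0 \<le> phat n \<omega> $ k" for n \<omega> k
    by (simp add: phat_def sum_nonneg)
  \<comment> \<open>At \<open>n = 0\<close> the division by zero makes the frequency vector zero.
    For positive \<open>n\<close>, each observed pattern is \<open>pat k\<close> for exactly one
    \<open>k\<close>.\<close>
  have phat_sum: "(\<Sum>k\<in>UNIV. phat n \<omega> $ k) = 1" if "n > 0" for n \<omega>
  proof -
    have one: "(\<Sum>k\<in>UNIV. if OP t \<omega> = pat k then 1 else 0) = (1::real)" for t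
    proof -
      have "OP t \<omega> \<in> range pat"
        using pat ordpat_permutes by (auto simp: OP_def bij_betw_def)
      then obtain k where "OP t \<omega> = pat k" by blast
      then have "OP t \<omega> = pat k' \<longleftrightarrow> k' = k" for k'
        using pat by (auto simp: bij_betw_def inj_eq)
      then show ?thesis by simp
    qed
    have "(\<Sum>k\<in>UNIV. phat n \<omega> $ k)
        = (1 / real n) * (\<Sum>k\<in>UNIV. \<Sum>t\<in>{1..n}. if OP t \<omega> = pat k then 1 else 0)"
      by (simp add: phat_def sum_distrib_left)
    also have "\<dots> = (1 / real n) * (\<Sum>t\<in>{1..n}. \<Sum>k\<in>UNIV. if OP t \<omega> = pat k then 1 else 0)"
      by (subst sum.swap) simp
    finally show ?thesis
      using that by (simp add: one)
  qed

  \<comment> \<open>The statistic as a function of the scaled deviation\<close>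
  define W where "W = (\<lambda>n \<omega>. (real n * (shannon (phat n \<omega>) / ln (fact m) - 1),
                 real n * complexity m (phat n \<omega>)))"
  define G where "G z = (- (K / (2 * \<Lambda>)) * (norm z)\<^sup>2, K / 8 * D0 m * (norm z)\<^sup>2)" for z :: "real^'k"
  \<comment> \<open>At \<open>z = Z n \<omega>\<close>, the choice \<open>a = K\<close> produces the
    arguments \<open>K * q $ k\<close> of the entropy, and \<open>a = K / 2\<close> the midpoint
    arguments \<open>(K * q $ k + 1) / 2\<close>.\<close>
  define S where "S a n z = (\<Sum>k\<in>UNIV. real n * relent (1 + a * z $ k / sqrt (real n)))"
    for a n and z :: "real^'k"
  \<comment> \<open>In the second component the middle factor is \<open>n\<close> times the
    disequilibrium. The last is the normalised entropy, where \<open>1 / n\<close> undoes the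
    scaling in \<open>S\<close>; it tends to one.\<close>
  define Gn where "Gn n z = (- (1 / (K * \<Lambda>)) * S K n z,
      D0 m * (1 / (2 * K) * S K n z - 1 / K * S (K / 2) n z) * (1 - 1 / (K * \<Lambda> * real n) * S K n z))"
    for n z
  have W_eq: "W n \<omega> = Gn n (Z n \<omega>)" if n: "n > 0" for n \<omega>
  proof -
    define q where "q = phat n \<omega>"
    have q: "\<And>k. 0 \<le> q $ k" "(\<Sum>k\<in>UNIV. q $ k) = 1"
      using phat_nonneg phat_sum[OF n] by (auto simp: q_def)
    have Zk: "a * Z n \<omega> $ k / sqrt (real n) = a * (q $ k - 1 / K)" for a k
      using n by (simp add: Z_def q_def p_unif unif_def K_def)
    define a where "a = (\<Sum>k\<in>UNIV. relent (K * q $ k))"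
    define b where "b = (\<Sum>k\<in>UNIV. relent ((K * q $ k + 1) / 2))"
    have arg: "1 + K * (x - 1 / K) = K * x" "1 + K / 2 * (x - 1 / K) = (K * x + 1) / 2" for x
      using K by (auto simp: field_simps)
    have Sa: "S K n (Z n \<omega>) = real n * a"
      unfolding S_def Zk arg a_def by (simp add: sum_distrib_left)
    have Sb: "S (K / 2) n (Z n \<omega>) = real n * b"
      unfolding S_def Zk arg b_def by (simp add: sum_distrib_left)
    have H: "shannon q = \<Lambda> - a / K"
      using shannon_eq_relent[OF q] by (simp add: card \<Lambda>_def a_def)
    have D: "disequilibrium m q = a / (2 * K) - b / K"
      using disequilibrium_eq_relent[OF q card_k] by (simp add: K_def a_def b_def)
    show ?thesis
      unfolding W_def Gn_def Sa Sb complexity_def H0_def q_def[symmetric] H D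
      using K n by (simp add: K_def[symmetric] \<Lambda>_def[symmetric] field_simps)
  qed
  have unif: "uniform_limit (cball 0 R) Gn G sequentially" for R
  proof -
    have bdd: "bounded ((\<lambda>z::real^'k. c * (norm z)\<^sup>2) ` cball 0 R)" for c
      by (intro compact_imp_bounded compact_continuous_image continuous_intros) auto
    have S: "uniform_limit (cball 0 R) (S a) (\<lambda>z. a\<^sup>2 / 2 * (norm z)\<^sup>2) sequentially" for a
      unfolding S_def by (rule sum_relent_scaled_uniform_limit)
    have L1: "uniform_limit (cball 0 R) (\<lambda>n z. - (1 / (K * \<Lambda>)) * S K n z)
        (\<lambda>z. - (1 / (K * \<Lambda>)) * (K\<^sup>2 / 2 * (norm z)\<^sup>2)) sequentially"
      by (intro uniform_limit_intros S)
    have L2: "uniform_limit (cball 0 R) (\<lambda>n z. D0 m * (1 / (2 * K) * S K n z - 1 / K * S (K / 2) n z))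
        (\<lambda>z. D0 m * (1 / (2 * K) * (K\<^sup>2 / 2 * (norm z)\<^sup>2) - 1 / K * ((K / 2)\<^sup>2 / 2 * (norm z)\<^sup>2))) sequentially"
      by (intro bounded_linear_uniform_limit_intros uniform_limit_minus S)
    \<comment> \<open>The constant of the theorem arises as
      \<open>K / 4 - K / 8 = K / 8\<close>.\<close>
    have L2': "D0 m * (1 / (2 * K) * (K\<^sup>2 / 2 * x) - 1 / K * ((K / 2)\<^sup>2 / 2 * x)) = K / 8 * D0 m * x" for x
      using K by (simp add: field_simps power2_eq_square)
    have "(\<lambda>n. 1 / (K * \<Lambda> * real n)) \<longlonglongrightarrow> 0"
      using tendsto_mult_left[OF lim_1_over_n, of "1 / (K * \<Lambda>)"] by simp
    then have "uniform_limit (cball 0 R) (\<lambda>n z::real^'k. 1 / (K * \<Lambda> * real n)) (\<lambda>z. 0) sequentially"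
      by (auto simp: uniform_limit_iff tendsto_iff)
    then have "uniform_limit (cball 0 R) (\<lambda>n z. 1 / (K * \<Lambda> * real n) * S K n z)
        (\<lambda>z. 0 * (K\<^sup>2 / 2 * (norm z)\<^sup>2)) sequentially"
      by (rule uniform_lim_mult[OF _ S _ bdd]) (auto simp: image_constant_conv)
    then have L3: "uniform_limit (cball 0 R) (\<lambda>n z. 1 - 1 / (K * \<Lambda> * real n) * S K n z)
        (\<lambda>z. 1 - 0 * (K\<^sup>2 / 2 * (norm z)\<^sup>2)) sequentially"
      by (intro uniform_limit_minus uniform_limit_const)
    have L23: "uniform_limit (cball 0 R) (\<lambda>n z. D0 m * (1 / (2 * K) * S K n z - 1 / K * S (K / 2) n z)
        * (1 - 1 / (K * \<Lambda> * real n) * S K n z))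
        (\<lambda>z. K / 8 * D0 m * (norm z)\<^sup>2 * (1 - 0 * (K\<^sup>2 / 2 * (norm z)\<^sup>2))) sequentially"
      by (rule uniform_lim_mult[OF L2[unfolded L2'] L3 bdd]) (auto simp: image_constant_conv)
    \<comment> \<open>The vanishing term is kept so that \<open>G\<close> has literally the form of
      the limits in \<open>L1\<close> and \<open>L23\<close>.\<close>
    have G_eq: "G = (\<lambda>z. (- (1 / (K * \<Lambda>)) * (K\<^sup>2 / 2 * (norm z)\<^sup>2),
        K / 8 * D0 m * (norm z)\<^sup>2 * (1 - 0 * (K\<^sup>2 / 2 * (norm z)\<^sup>2))))"
      using K by (simp add: G_def fun_eq_iff power2_eq_square)
    show ?thesis
      unfolding Gn_def G_eq by (rule uniform_limit_Pair[OF L1 L23])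
  qed

  \<comment> \<open>Measurability and passage to the limit\<close>
  have "(\<lambda>q::real^'k. shannon q) \<in> borel_measurable borel"
    unfolding shannon_def by measurable
  then have [measurable]: "(\<lambda>\<omega>. shannon (f \<omega>)) \<in> borel_measurable M"
    if "f \<in> borel_measurable M" for f :: "'a \<Rightarrow> real^'k"
    using that by (rule measurable_compose_rev)
  have [measurable]: "W n \<in> borel_measurable M" for n
    unfolding W_def complexity_def disequilibrium_def by measurable
  have [measurable]: "Z n \<in> borel_measurable M" for n
    unfolding Z_def by measurable
  have sym: "transpose Sigma = Sigma"
    by (simp add: Sigma_def transpose_def vec_eq_iff algebra_simps)
  have \<mu>_prob: "prob_space \<mu>" "sets \<mu> = sets borel"
    using \<mu> by (auto simp: gaussian_measure_def)
  define Q where "Q \<omega> = (\<Sum>c\<in>nonzero_eigenvalues Sigma. c * Y c \<omega>)" for \<omega>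
  have [measurable]: "Q \<in> borel_measurable N"
    unfolding Q_def using Y by (auto dest!: distributed_measurable intro!: borel_measurable_sum)
  have G_cont: "continuous_on UNIV G"
    unfolding G_def by (intro continuous_intros)
  have "conv_distr M W (distr N borel (\<lambda>\<omega>. (- (K / (2 * \<Lambda>)) * Q \<omega>, K / 8 * D0 m * Q \<omega>)))"
    unfolding conv_distr_def
  proof (intro allI impI)
    fix g :: "real \<times> real \<Rightarrow> real"
    assume g: "continuous_on UNIV g" "bounded (range g)"
    have [measurable]: "g \<in> borel_measurable borel"
      using g(1) by (rule borel_measurable_continuous_onI)
    \<comment> \<open>\<open>G\<close> depends on \<open>z\<close> only through its squared norm, so
      the limit is an expectation of a one-dimensional test function and the law of the squared norm
      suffices.\<close>
    define h where "h x = g (- (K / (2 * \<Lambda>)) * x, K / 8 * D0 m * x)" for x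
    have h: "continuous_on UNIV h" "bounded (range h)"
    proof -
      show "continuous_on UNIV h"
        unfolding h_def by (intro continuous_on_compose2[OF g(1)] continuous_intros) auto
      show "bounded (range h)"
        by (rule bounded_subset[OF g(2)]) (auto simp: h_def)
    qed
    have "\<forall>\<^sub>F n in sequentially. \<forall>\<omega>\<in>space M. W n \<omega> = Gn n (Z n \<omega>)"
      using eventually_gt_at_top[of 0] by eventually_elim (simp add: W_eq)
    then have "(\<lambda>n. \<integral>\<omega>. g (W n \<omega>) \<partial>M) \<longlonglongrightarrow> (\<integral>x. g (G x) \<partial>\<mu>)"
      by (intro conv_distr_uniform_limit[OF M \<mu>_prob _ _ conv[folded Z_def] G_cont unif _ g]) auto
    also have "(\<integral>x. g (G x) \<partial>\<mu>) = (\<integral>x. h ((norm x)\<^sup>2) \<partial>\<mu>)"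
      by (simp add: h_def G_def)
    also have "\<dots> = (\<integral>\<omega>. h (Q \<omega>) \<partial>N)"
      unfolding Q_def using Y by (intro gaussian_measure_norm_square_law[OF \<mu> sym N indep _ h]) auto
    also have "\<dots> = (\<integral>x. g x \<partial>distr N borel (\<lambda>\<omega>. (- (K / (2 * \<Lambda>)) * Q \<omega>, K / 8 * D0 m * Q \<omega>)))"
      by (subst integral_distr) (auto simp: h_def)
    finally show "(\<lambda>n. \<integral>\<omega>. g (W n \<omega>) \<partial>M)
        \<longlonglongrightarrow> (\<integral>x. g x \<partial>distr N borel (\<lambda>\<omega>. (- (K / (2 * \<Lambda>)) * Q \<omega>, K / 8 * D0 m * Q \<omega>)))" .
  qed
  then show "conv_distr M
       (\<lambda>n \<omega>. (real n * (shannon (phat n \<omega>) / ln (fact m) - 1),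
                 real n * complexity m (phat n \<omega>)))
       (distr N borel (\<lambda>\<omega>. let Q = (\<Sum>c\<in>nonzero_eigenvalues Sigma. c * Y c \<omega>) in
          (- (fact m / (2 * ln (fact m))) * Q, fact m / 8 * D0 m * Q)))"
    unfolding W_def Q_def K_def \<Lambda>_def Let_def .
qed

end
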